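(* Fix a tolerance level $\delta>0$. Let $f:\mathbb{R}^d\to\mathbb{R}$ be $d$-times continuously differentiable (and twice continuously differentiable), and let $x^*$ be a regular minimizer of $f$, i.e. a local minimizer with $\nabla^2 f(x^* )\succ 0$. Suppose that, for some $q\in[2,\infty]$ and $\sigma\ge 0$, the oracle error satisfies $\mathbb{E}[Z(x;\omega)]=0$ and $\mathbb{E}[\|Z(x;\omega)\|^q]\le\sigma^q$ for all $x\in\mathbb{R}^d$ (for $q=\infty$, the latter means $\|Z(x;\omega)\|\le\sigma$ almost surely). Assume stochastic gradient descent $X_{n+1}=X_n-\gamma_nV_n$ is run with a step-size schedule of the form $\gamma_n=\gamma/(n+m)^p$ for some $p\in(2/(q+2),1]$ (where $2/(q+2)=0$ if $q=\infty$) and large enough $m,\gamma>0$ (that is, $\gamma$ exceeds some threshold, and $m$ exceeds some threshold that may depend on $\gamma$). Then there exist neighborhoods $\mathcal U$ and $\mathcal U_1$ of $x^*$ such that, if $X_1\in\mathcal U_1$: (1) the event $\Omega_{\mathcal U}=\{X_n\in\mathcal U\text{ for all }n=1,2,\dots\}$ occurs with probability at least $1-\delta$; (2) conditioned on $\Omega_{\mathcal U}$, we have $\mathbb{E}[\|X_n-x^*\|^2\mid\Omega_{\mathcal U}]=O(1/n^p)$.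
   Context: $\|\cdot\|$ is the Euclidean norm on $\mathbb{R}^d$. Oracle and algorithm. A stochastic first-order oracle returns, at input $x\in\mathbb{R}^d$, the random vector $\mathsf V(x;\omega)=\nabla f(x)+Z(x;\omega)$, with $\omega$ drawn from a complete probability space. Stochastic gradient descent is $X_{n+1}=X_n-\gamma_n V_n$, $n=1,2,\dots$, with step-sizes $\gamma_n>0$ and $V_n=\mathsf V(X_n;\omega_n)=\nabla f(X_n)+Z_n$, $Z_n=Z(X_n;\omega_n)$, where $\omega_n$ is a fresh draw of the random seed, independent of $\mathcal F_n=\sigma(X_1,\dots,X_n)$; thus $\mathbb{E}[Z_n\mid\mathcal F_n]=0$ and $\mathbb{E}[\|Z_n\|^q\mid\mathcal F_n]\le\sigma^q$. No global Lipschitz, smoothness, or sublevel-set assumption on $f$ is imposed in this result. *)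

theory Defs
  imports "HOL-Probability.Probability" "HOL-Library.Landau_Symbols"
begin

text \<open>Finite-dimensional rendering of \<open>C\<^sup>k\<close>: all iterated directional derivatives up to
  order \<open>k\<close> exist (with Frechet differentiability at every stage below \<open>k\<close>) and are continuous.\<close>

primrec continuously_diff :: "nat \<Rightarrow> ('a::euclidean_space \<Rightarrow> real) \<Rightarrow> bool" where
  "continuously_diff 0 f \<longleftrightarrow> continuous_on UNIV f"
| "continuously_diff (Suc k) f \<longleftrightarrow>
     (\<forall>x. f differentiable (at x)) \<and>
     (\<forall>v. continuously_diff k (\<lambda>x. frechet_derivative f (at x) v))"

definition grad :: "(real ^ 'n \<Rightarrow> real) \<Rightarrow> real ^ 'n \<Rightarrow> real ^ 'n" where
  "grad f x = (THE D. GDERIV f x :> D)"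

definition hessian :: "(real ^ 'n \<Rightarrow> real) \<Rightarrow> real ^ 'n \<Rightarrow> real ^ 'n ^ 'n" where
  "hessian f x = jacobian (grad f) (at x)"

definition pos_def :: "real ^ 'n ^ 'n \<Rightarrow> bool" where
  "pos_def A \<longleftrightarrow> transpose A = A \<and> (\<forall>v. v \<noteq> 0 \<longrightarrow> v \<bullet> (A *v v) > 0)"

definition regular_minimizer :: "(real ^ 'n \<Rightarrow> real) \<Rightarrow> real ^ 'n \<Rightarrow> bool" where
  "regular_minimizer f x \<longleftrightarrow> (\<forall>\<^sub>F y in nhds x. f x \<le> f y) \<and> pos_def (hessian f x)"

text \<open>The zero-mean condition and the bound on the \<open>q\<close>-th moment, for \<open>q \<in> [2, \<infinity>]\<close>. Joint
  measurability of \<open>(x, \<omega>) \<mapsto> Z(x; \<omega>)\<close> is what makes \<open>Z(X\<^sub>n; \<omega>\<^sub>n)\<close> a random variable. The moment is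
  a nonnegative integral, so the bound includes its finiteness.\<close>

definition oracle_error ::
    "'w measure \<Rightarrow> (real ^ 'n \<Rightarrow> 'w \<Rightarrow> real ^ 'n) \<Rightarrow> ereal \<Rightarrow> real \<Rightarrow> bool" where
  "oracle_error P Z q \<sigma> \<longleftrightarrow>
     (\<lambda>(x, \<omega>). Z x \<omega>) \<in> borel_measurable (borel \<Otimes>\<^sub>M P) \<and>
     (\<forall>x. integrable P (Z x) \<and> (\<integral>\<omega>. Z x \<omega> \<partial>P) = 0) \<and>
     (\<forall>x. if q = \<infinity> then AE \<omega> in P. norm (Z x \<omega>) \<le> \<sigma>
          else (\<integral>\<^sup>+\<omega>. ennreal (norm (Z x \<omega>) powr real_of_ereal q) \<partial>P)
                 \<le> ennreal (\<sigma> powr real_of_ereal q))"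

definition sgd_oracle ::
    "(real ^ 'n \<Rightarrow> real) \<Rightarrow> (real ^ 'n \<Rightarrow> 'w \<Rightarrow> real ^ 'n) \<Rightarrow> real ^ 'n \<Rightarrow> 'w \<Rightarrow> real ^ 'n" where
  "sgd_oracle f Z x \<omega> = grad f x + Z x \<omega>"

definition natural_filtration :: "'s measure \<Rightarrow> (nat \<Rightarrow> 's \<Rightarrow> real ^ 'n) \<Rightarrow> nat \<Rightarrow> 's set set" where
  "natural_filtration M X n =
     sigma_sets (space M) (\<Union>i\<in>{1..n}. {X i -` B \<inter> space M | B. B \<in> sets borel})"

text \<open>A run of stochastic gradient descent on the probability space \<open>M\<close>: \<open>W n\<close> is the seed drawn
  from \<open>P\<close> at step \<open>n\<close>. Indices start at 1; \<open>X 0\<close> and \<open>W 0\<close> are irrelevant. The initial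
  point \<open>X 1\<close> may be random.\<close>

definition sgd_run ::
    "(real ^ 'n \<Rightarrow> real) \<Rightarrow> 'w measure \<Rightarrow> (real ^ 'n \<Rightarrow> 'w \<Rightarrow> real ^ 'n) \<Rightarrow> (nat \<Rightarrow> real) \<Rightarrow>
     's measure \<Rightarrow> (nat \<Rightarrow> 's \<Rightarrow> real ^ 'n) \<Rightarrow> (nat \<Rightarrow> 's \<Rightarrow> 'w) \<Rightarrow> bool" where
  "sgd_run f P Z step M X W \<longleftrightarrow>
     prob_space M \<and>
     (\<forall>n\<ge>1. X n \<in> borel_measurable M) \<and>
     (\<forall>n\<ge>1. W n \<in> measurable M P \<and> distr M P (W n) = P \<and>
        prob_space.indep_set M (natural_filtration M X n)
          {W n -` B \<inter> space M | B. B \<in> sets P}) \<and>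
     (\<forall>n\<ge>1. \<forall>s\<in>space M. X (Suc n) s = X n s - step n *\<^sub>R sgd_oracle f Z (X n s) (W n s))"

definition stay_event :: "'s measure \<Rightarrow> (nat \<Rightarrow> 's \<Rightarrow> real ^ 'n) \<Rightarrow> (real ^ 'n) set \<Rightarrow> 's set" where
  "stay_event M X U = {s \<in> space M. \<forall>n\<ge>1. X n s \<in> U}"

end

theory Submission
  imports Defs
begin

text \<open>
  Near a regular minimizer \<open>xs\<close> the gradient is linear up to a small error with a positive definite
  linear part, so on some ball \<open>\<langle>\<nabla>f(x), x - xs\<rangle> \<ge> a r\<^sup>2\<close> and \<open>\<parallel>\<nabla>f(x)\<parallel> \<le> L r\<close> with \<open>r = \<parallel>x - xs\<parallel>\<close>
  (\<open>regular_minimizer_drift\<close>). A noiseless step of small size \<open>g\<close> therefore multiplies \<open>r\<^sup>2\<close> by at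
  most \<open>1 - a g\<close>.

  The noise is handled with the Lyapunov function \<open>r\<^sup>s\<close>, where \<open>s \<ge> 2\<close> is a finite exponent for which
  the oracle error has a bounded moment. The second-order expansion of \<open>\<parallel>y + h\<parallel>\<^sup>s\<close> has a linear term, which
  averages out because the noise is centred, and a remainder of order
  \<open>g\<^sup>2 r\<^bsup>s-2\<^esup> + g\<^sup>s\<close>. Young's inequality trades \<open>g \<cdot> (g r\<^bsup>s-2\<^esup>)\<close> for \<open>g \<cdot> (\<epsilon> r\<^sup>s + K g\<^bsup>s/2\<^esup>)\<close>, so a single step
  gives
    \<open>E r\<^bsub>n+1\<^esub>\<^sup>s \<le> (1 - a g / 2) r\<^bsub>n\<^esub>\<^sup>s + K g\<^bsup>1+s/2\<^esup>\<close>
  as long as the iterate is in the ball (\<open>nn_integral_norm_powr_step_le\<close>). The lower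
  bound on the step-size exponent permits a choice of \<open>s\<close> for which \<open>\<Sum> g\<^sub>n\<^bsup>1+s/2\<^esup>\<close> converges, even when
  \<open>\<Sum> g\<^sub>n\<^sup>2\<close> does not.

  For the stay probability, let \<open>F\<^sub>n\<close> be the expectation of \<open>r\<^sub>n\<^sup>s\<close> on the event that the first \<open>n\<close>
  iterates are in the ball of radius \<open>\<rho>\<close>. A run that leaves at time \<open>n + 1\<close> has \<open>r\<^bsub>n+1\<^esub> \<ge> \<rho>\<close>, so each
  exit costs \<open>\<rho>\<^sup>s\<close> times its probability out of the budget \<open>F\<^sub>1 + K \<Sum> g\<^sub>n\<^bsup>1+s/2\<^esup>\<close>
  (\<open>prob_stay_event_ge\<close>). A start close to \<open>xs\<close> and a large shift \<open>m\<close> make this budget as small as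
  desired.

  For the rate, the same one-step bound with \<open>s = 2\<close> is the recursion
  \<open>u\<^bsub>n+1\<^esub> \<le> (1 - a g\<^sub>n / 2) u\<^sub>n + K g\<^sub>n\<^sup>2\<close>, whose solutions are \<open>O(n\<^bsup>-p\<^esup>)\<close> once \<open>a \<gamma> / 2 \<ge> 2\<close>
  (\<open>chung_recursion_bound\<close>). Conditioning on an event of probability at least \<open>1/2\<close> costs a factor \<open>2\<close>.
\<close>

section \<open>Powers of the norm under a small centred perturbation\<close>

text \<open>From \<open>1 + z \<le> exp z\<close> and the second-order expansion of \<open>exp (s z)\<close>; the exponent of the remainder
  is bounded because \<open>\<bar>s z\<bar> \<le> s\<close>.\<close>

lemma powr_one_plus_le:
  fixes s z :: real
  assumes "s \<ge> 0" "\<bar>z\<bar> < 1"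
  shows "(1 + z) powr s \<le> 1 + s * z + s\<^sup>2 * exp s * z\<^sup>2"
proof -
  have "(1 + z) powr s \<le> exp z powr s"
    using assms by (intro powr_mono2) (auto simp: exp_ge_add_one_self)
  also have "\<dots> = exp (s * z)"
    by (simp add: powr_def)
  also obtain t where t: "\<bar>t\<bar> \<le> \<bar>s * z\<bar>" and e: "exp (s * z) = 1 + s * z + exp t / 2 * (s * z)\<^sup>2"
    using Maclaurin_exp_le[of "s * z" 2] by (auto simp: numeral_2_eq_2)
  have "\<bar>s * z\<bar> \<le> s"
    using assms by (simp add: abs_mult mult_left_le)
  hence "exp t / 2 \<le> exp s"
    using t by (smt (verit) exp_gt_zero exp_le_cancel_iff field_sum_of_halves)
  hence "exp t / 2 * (s * z)\<^sup>2 \<le> exp s * (s * z)\<^sup>2"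
    by (intro mult_right_mono) auto
  hence "exp (s * z) \<le> 1 + s * z + s\<^sup>2 * exp s * z\<^sup>2"
    unfolding e by (simp add: power_mult_distrib mult_ac)
  finally show ?thesis .
qed

lemma norm_powr_eq_square_powr: "norm x powr s = ((norm x)\<^sup>2) powr (s / 2)"
  by (cases "x = 0") (simp_all add: powr_powr flip: powr_numeral)

text \<open>Second-order expansion of the map \<open>y \<mapsto> \<parallel>y\<parallel>\<^sup>s\<close>, keeping the linear term exact so that it vanishes when \<open>h\<close> is
  averaged over centred noise. For \<open>h\<close> small relative to \<open>y\<close> the bound is an expansion of
  \<open>(1 + z)\<^bsup>s/2\<^esup>\<close>; otherwise all terms are dominated by \<open>\<parallel>h\<parallel>\<^sup>s\<close>.\<close>

lemma norm_add_powr_le: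
  fixes s :: real
  assumes "s \<ge> 2"
  shows "\<exists>C\<ge>0. \<forall>y h :: 'a::real_inner.
    norm (y + h) powr s \<le> norm y powr s + s * norm y powr (s - 2) * (y \<bullet> h)
      + C * (norm y powr (s - 2) * (norm h)\<^sup>2 + norm h powr s)"
proof -
  define C1 where "C1 = (s / 2)\<^sup>2 * exp (s / 2)"
  \<comment> \<open>\<open>81/16\<close> is the square of \<open>9/4\<close>, from \<open>\<bar>2 \<langle>y, h\<rangle> + \<parallel>h\<parallel>\<^sup>2\<bar> \<le> (9/4) \<parallel>y\<parallel> \<parallel>h\<parallel>\<close> when \<open>4 \<parallel>h\<parallel> < \<parallel>y\<parallel>\<close>; the last two terms come
    from \<open>\<parallel>y + h\<parallel> \<le> 5 \<parallel>h\<parallel>\<close> and \<open>\<parallel>y\<parallel> \<le> 4 \<parallel>h\<parallel>\<close> in the other case.\<close>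
  define C where "C = s / 2 + C1 * (81 / 16) + 5 powr s + s * 4 powr (s - 1)"
  have C1: "C1 \<ge> 0" and C0: "C \<ge> 0" using assms by (auto simp: C1_def C_def)
  have "norm (y + h) powr s \<le> norm y powr s + s * norm y powr (s - 2) * (y \<bullet> h)
      + C * (norm y powr (s - 2) * (norm h)\<^sup>2 + norm h powr s)" for y h :: 'a
  proof (cases "4 * norm h < norm y")
    case True
    \<comment> \<open>\<open>\<parallel>y + h\<parallel>\<^sup>2 = u (1 + z)\<close> with \<open>\<bar>z\<bar> < 1\<close>.\<close>
    define u where "u = (norm y)\<^sup>2"
    define v where "v = 2 * (y \<bullet> h) + (norm h)\<^sup>2"
    define z where "z = v / u"
    have y: "norm y > 0" using True norm_ge_zero[of h] by linarith
    hence u: "u > 0" by (simp add: u_def)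
    have uz: "u * z = v" using u by (simp add: z_def)
    have "\<bar>v\<bar> \<le> 2 * (norm y * norm h) + norm h * norm h"
      using Cauchy_Schwarz_ineq2[of y h] unfolding v_def power2_eq_square
      by (smt (verit) mult_nonneg_nonneg norm_ge_zero)
    also have "norm h * norm h \<le> norm y / 4 * norm h"
      using True by (intro mult_right_mono) auto
    finally have v: "\<bar>v\<bar> \<le> 9 / 4 * (norm y * norm h)" by (simp add: mult.commute)
    also have "norm y * norm h \<le> norm y * (norm y / 4)"
      using True by (intro mult_left_mono) auto
    finally have "\<bar>v\<bar> \<le> 9 / 16 * u" by (simp add: u_def power2_eq_square)
    hence "\<bar>v\<bar> < u" using u by linarith
    hence z: "\<bar>z\<bar> < 1" using u by (simp add: z_def)
    have "\<bar>v\<bar>\<^sup>2 \<le> (9 / 4 * (norm y * norm h))\<^sup>2"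
      using v by (intro power_mono) auto
    hence "u * (u * z\<^sup>2) \<le> u * (81 / 16 * (norm h)\<^sup>2)"
      by (simp add: uz[symmetric] power_mult_distrib power2_eq_square u_def mult_ac)
    hence uz2: "u * z\<^sup>2 \<le> 81 / 16 * (norm h)\<^sup>2" using u by simp
    have split: "norm y powr s = norm y powr (s - 2) * u"
      using y by (simp add: u_def powr_diff powr_numeral)
    have "(norm (y + h))\<^sup>2 = u * (1 + z)"
      unfolding distrib_left uz
      by (simp add: u_def v_def power2_norm_eq_inner inner_add_left inner_add_right inner_commute)
    hence "norm (y + h) powr s = (u * (1 + z)) powr (s / 2)"
      by (simp add: norm_powr_eq_square_powr)
    also have "\<dots> = norm y powr s * (1 + z) powr (s / 2)"
      using u z by (simp add: powr_mult norm_powr_eq_square_powr u_def)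
    also have "\<dots> \<le> norm y powr s * (1 + s / 2 * z + C1 * z\<^sup>2)"
      unfolding C1_def using assms z by (intro mult_left_mono powr_one_plus_le) auto
    also have "\<dots> = norm y powr s + norm y powr (s - 2) * (s / 2 * (u * z) + C1 * (u * z\<^sup>2))"
      unfolding split by (simp add: algebra_simps)
    also have "\<dots> \<le> norm y powr s + norm y powr (s - 2) * (s / 2 * v + C1 * (81 / 16 * (norm h)\<^sup>2))"
      unfolding uz using C1 uz2 by (intro add_left_mono mult_left_mono) auto
    also have "\<dots> = norm y powr s + s * norm y powr (s - 2) * (y \<bullet> h)
        + (s / 2 + C1 * (81 / 16)) * (norm y powr (s - 2) * (norm h)\<^sup>2)"
      by (simp add: v_def algebra_simps)
    also have "\<dots> \<le> norm y powr s + s * norm y powr (s - 2) * (y \<bullet> h)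
        + C * (norm y powr (s - 2) * (norm h)\<^sup>2 + norm h powr s)"
      using assms C1 by (intro add_left_mono mult_mono) (auto simp: C_def)
    finally show ?thesis .
  next
    case False
    have "norm (y + h) \<le> 5 * norm h" using norm_triangle_ineq[of y h] False by linarith
    hence "norm (y + h) powr s \<le> (5 * norm h) powr s"
      using assms by (intro powr_mono2) auto
    hence 1: "norm (y + h) powr s \<le> 5 powr s * norm h powr s" by (simp add: powr_mult)
    have "\<bar>norm y powr (s - 2) * (y \<bullet> h)\<bar> \<le> norm y powr (s - 2) * (norm y * norm h)"
      using Cauchy_Schwarz_ineq2[of y h] by (simp add: abs_mult mult_left_mono)
    also have "\<dots> \<le> (4 * norm h) powr (s - 2) * ((4 * norm h) * norm h)"
      using False assms by (intro mult_mono powr_mono2) auto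
    also have "\<dots> = 4 powr (s - 1) * norm h powr s"
      by (cases "h = 0") (simp_all add: powr_mult powr_diff powr_numeral power2_eq_square)
    finally have "- (s * (norm y powr (s - 2) * (y \<bullet> h))) \<le> s * (4 powr (s - 1) * norm h powr s)"
      using assms by (smt (verit) mult_left_mono mult_minus_right)
    moreover have "(5 powr s + s * 4 powr (s - 1)) * norm h powr s
        \<le> C * (norm y powr (s - 2) * (norm h)\<^sup>2 + norm h powr s)"
      using assms C1 by (intro mult_mono) (auto simp: C_def)
    moreover have "norm y powr s \<ge> 0" by simp
    ultimately show ?thesis using 1 unfolding mult.assoc distrib_right by linarith
  qed
  with C0 show ?thesis by blast
qed

text \<open>Young's inequality with exponents \<open>s/(s - 2)\<close> and \<open>s/2\<close>, proved by comparing \<open>b g\<close> with \<open>a r\<^sup>2\<close>: either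
  the left-hand side is at most \<open>a r\<^sup>s\<close>, or \<open>r\<close> is at most of order \<open>\<surd>g\<close>. The case distinction also covers
  \<open>s = 2\<close>, where the first exponent degenerates.\<close>

lemma weighted_young_powr:
  fixes s a b :: real
  assumes "s \<ge> 2" "a > 0" "b \<ge> 0"
  shows "\<exists>K\<ge>0. \<forall>g r. 0 \<le> g \<longrightarrow> 0 \<le> r \<longrightarrow> b * g * r powr (s - 2) \<le> a * r powr s + K * g powr (s / 2)"
proof (intro exI conjI allI impI)
  show "b * (b / a) powr (s / 2 - 1) \<ge> 0" using assms by simp
  fix g r :: real assume g: "0 \<le> g" and r: "0 \<le> r"
  show "b * g * r powr (s - 2) \<le> a * r powr s + b * (b / a) powr (s / 2 - 1) * g powr (s / 2)"
  proof (cases "b * g \<le> a * r\<^sup>2")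
    case True
    have "b * g * r powr (s - 2) \<le> a * r\<^sup>2 * r powr (s - 2)"
      using True by (intro mult_right_mono) auto
    also have "\<dots> = a * r powr s"
      using r by (cases "r = 0") (simp_all add: powr_diff powr_numeral)
    finally show ?thesis using assms by (smt (verit) mult_nonneg_nonneg powr_ge_zero)
  next
    case False
    hence "r\<^sup>2 \<le> b / a * g" using assms by (simp add: field_simps)
    hence "(r\<^sup>2) powr (s / 2 - 1) \<le> (b / a * g) powr (s / 2 - 1)"
      using assms by (intro powr_mono2) auto
    also have "(r\<^sup>2) powr (s / 2 - 1) = r powr (s - 2)"
      using norm_powr_eq_square_powr[of r "s - 2"] r by (simp add: diff_divide_distrib)
    finally have "b * g * r powr (s - 2) \<le> b * g * (b / a * g) powr (s / 2 - 1)"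
      using assms g by (intro mult_left_mono) auto
    also have "\<dots> = b * (b / a) powr (s / 2 - 1) * g powr (s / 2)"
      using assms g by (cases "g = 0") (simp_all add: powr_mult powr_diff powr_divide)
    finally show ?thesis using assms by (smt (verit) mult_nonneg_nonneg powr_ge_zero)
  qed
qed

text \<open>One step from a point at distance \<open>r\<close>: \<open>y\<close> stands for the displacement after the noiseless part of
  the step, \<open>\<zeta>\<close> for the noise and \<open>g\<close> for the step size. The constant depends only on \<open>s\<close>, \<open>a\<close> and the
  moment bound, so it is the same for all points and all steps. Half of the contraction pays for the
  cross term \<open>g\<^sup>2 r\<^bsup>s-2\<^esup>\<close>.\<close>

lemma nn_integral_norm_powr_step_le:
  fixes s a S :: real
  assumes "s \<ge> 2" "a > 0" "S \<ge> 0"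
  shows "\<exists>K\<ge>0. \<forall>(Q :: 'w measure) (\<zeta> :: 'w \<Rightarrow> 'a::euclidean_space) g r y.
    prob_space Q \<longrightarrow> integrable Q \<zeta> \<longrightarrow> (\<integral>\<omega>. \<zeta> \<omega> \<partial>Q) = 0 \<longrightarrow>
    (\<integral>\<^sup>+\<omega>. ennreal ((norm (\<zeta> \<omega>))\<^sup>2) \<partial>Q) \<le> ennreal S \<longrightarrow>
    (\<integral>\<^sup>+\<omega>. ennreal (norm (\<zeta> \<omega>) powr s) \<partial>Q) \<le> ennreal S \<longrightarrow>
    0 < g \<longrightarrow> g \<le> 1 \<longrightarrow> a * g \<le> 1 \<longrightarrow> 0 \<le> r \<longrightarrow> (norm y)\<^sup>2 \<le> (1 - a * g) * r\<^sup>2 \<longrightarrow>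
    (\<integral>\<^sup>+\<omega>. ennreal (norm (y - g *\<^sub>R \<zeta> \<omega>) powr s) \<partial>Q)
      \<le> ennreal ((1 - a / 2 * g) * r powr s + K * g powr (s / 2 + 1))"
proof -
  obtain C where C0: "C \<ge> 0" and C: "\<And>y h :: 'a. norm (y + h) powr s \<le> norm y powr s
      + s * norm y powr (s - 2) * (y \<bullet> h)
      + C * (norm y powr (s - 2) * (norm h)\<^sup>2 + norm h powr s)"
    using norm_add_powr_le[OF assms(1), where ?'a = 'a] by blast
  obtain K1 where K10: "K1 \<ge> 0" and K1: "\<And>g r. 0 \<le> g \<Longrightarrow> 0 \<le> r \<Longrightarrow>
      (C * S) * g * r powr (s - 2) \<le> (a / 2) * r powr s + K1 * g powr (s / 2)"
    using weighted_young_powr[of s "a / 2" "C * S"] assms C0 by auto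
  show ?thesis
  proof (intro exI[of _ "K1 + C * S"] conjI allI impI)
    show "K1 + C * S \<ge> 0" using K10 C0 assms by simp
    fix Q :: "'w measure" and \<zeta> :: "'w \<Rightarrow> 'a" and g r :: real and y :: 'a
    assume Q: "prob_space Q" and int: "integrable Q \<zeta>" and zero: "(\<integral>\<omega>. \<zeta> \<omega> \<partial>Q) = 0"
      and n2: "(\<integral>\<^sup>+\<omega>. ennreal ((norm (\<zeta> \<omega>))\<^sup>2) \<partial>Q) \<le> ennreal S"
      and ns: "(\<integral>\<^sup>+\<omega>. ennreal (norm (\<zeta> \<omega>) powr s) \<partial>Q) \<le> ennreal S"
      and g: "0 < g" "g \<le> 1" "a * g \<le> 1" and r: "0 \<le> r"
      and y: "(norm y)\<^sup>2 \<le> (1 - a * g) * r\<^sup>2"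
    interpret Q: prob_space Q by (rule Q)
    have [measurable]: "\<zeta> \<in> borel_measurable Q" using int by simp
    have i2: "integrable Q (\<lambda>\<omega>. (norm (\<zeta> \<omega>))\<^sup>2)"
      using n2 by (intro integrableI_bounded) (auto simp: le_less_trans)
    have isq: "integrable Q (\<lambda>\<omega>. norm (\<zeta> \<omega>) powr s)"
      using ns by (intro integrableI_bounded) (auto simp: le_less_trans)
    define m2 where "m2 = (\<integral>\<omega>. (norm (\<zeta> \<omega>))\<^sup>2 \<partial>Q)"
    define ms where "ms = (\<integral>\<omega>. norm (\<zeta> \<omega>) powr s \<partial>Q)"
    have m2: "m2 \<le> S" using n2 assms unfolding m2_def by (subst (asm) nn_integral_eq_integral[OF i2]) auto
    have ms: "ms \<le> S" using ns assms unfolding ms_def by (subst (asm) nn_integral_eq_integral[OF isq]) auto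
    \<comment> \<open>The pointwise bound on the \<open>s\<close>-th power of the new distance; its linear term has mean zero.\<close>
    define R where "R \<omega> = norm y powr s - s * norm y powr (s - 2) * g * (y \<bullet> \<zeta> \<omega>)
      + C * (norm y powr (s - 2) * g\<^sup>2 * (norm (\<zeta> \<omega>))\<^sup>2 + g powr s * norm (\<zeta> \<omega>) powr s)" for \<omega>
    have R: "norm (y - g *\<^sub>R \<zeta> \<omega>) powr s \<le> R \<omega>" for \<omega>
      using C[of y "- (g *\<^sub>R \<zeta> \<omega>)"] g
      by (simp add: R_def powr_mult power_mult_distrib mult_ac)
    have iR: "integrable Q R"
      unfolding R_def using int i2 isq by auto
    have "(\<integral>\<omega>. R \<omega> \<partial>Q) = norm y powr s + C * (norm y powr (s - 2) * g\<^sup>2 * m2 + g powr s * ms)"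
      unfolding R_def m2_def ms_def using int i2 isq
      by (simp add: zero Q.prob_space)
    also have "\<dots> \<le> norm y powr s + C * (norm y powr (s - 2) * g\<^sup>2 * S + g powr s * S)"
      using m2 ms C0 by (intro add_left_mono mult_left_mono add_mono) auto
    also have "norm y powr s \<le> (1 - a * g) * r powr s"
    proof -
      have "norm y powr s \<le> ((1 - a * g) * r\<^sup>2) powr (s / 2)"
        unfolding norm_powr_eq_square_powr[of y] using y assms by (intro powr_mono2) auto
      also have "\<dots> = (1 - a * g) powr (s / 2) * r powr s"
        using g r norm_powr_eq_square_powr[of r s] by (simp add: powr_mult)
      also have "(1 - a * g) powr (s / 2) \<le> (1 - a * g) powr 1"
        using g assms by (intro powr_mono') auto
      finally show ?thesis using g by (simp add: mult_right_mono)
    qed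
    also have "norm y powr (s - 2) * g\<^sup>2 * S \<le> r powr (s - 2) * g\<^sup>2 * S"
    proof -
      have "(1 - a * g) * r\<^sup>2 \<le> 1 * r\<^sup>2" using g assms by (intro mult_right_mono) auto
      hence "(norm y)\<^sup>2 \<le> r\<^sup>2" using y by linarith
      hence "norm y \<le> r" using r by (rule power2_le_imp_le)
      thus ?thesis using assms by (intro mult_right_mono powr_mono2) auto
    qed
    \<comment> \<open>As \<open>g \<le> 1\<close> and \<open>s \<ge> s/2 + 1\<close>.\<close>
    also have "g powr s * S \<le> g powr (s / 2 + 1) * S"
      using g assms by (intro mult_right_mono powr_mono') auto
    also have "C * (r powr (s - 2) * g\<^sup>2 * S + g powr (s / 2 + 1) * S)
        = g * ((C * S) * g * r powr (s - 2)) + C * S * g powr (s / 2 + 1)"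
      by (simp add: algebra_simps power2_eq_square)
    also have "g * ((C * S) * g * r powr (s - 2)) \<le> g * ((a / 2) * r powr s + K1 * g powr (s / 2))"
      using g r by (intro mult_left_mono K1) auto
    also have "(1 - a * g) * r powr s + (g * ((a / 2) * r powr s + K1 * g powr (s / 2)) + C * S * g powr (s / 2 + 1))
       = (1 - a / 2 * g) * r powr s + (K1 + C * S) * g powr (s / 2 + 1)"
      using g by (simp add: algebra_simps powr_add)
    finally have le: "(\<integral>\<omega>. R \<omega> \<partial>Q) \<le> (1 - a / 2 * g) * r powr s + (K1 + C * S) * g powr (s / 2 + 1)"
      using C0 by (simp add: mult_left_mono add_mono)
    have "(\<integral>\<^sup>+\<omega>. ennreal (norm (y - g *\<^sub>R \<zeta> \<omega>) powr s) \<partial>Q) \<le> (\<integral>\<^sup>+\<omega>. ennreal (R \<omega>) \<partial>Q)"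
      using R by (intro nn_integral_mono ennreal_leI) auto
    also have "\<dots> = ennreal (\<integral>\<omega>. R \<omega> \<partial>Q)"
    proof (rule nn_integral_eq_integral[OF iR])
      show "AE \<omega> in Q. 0 \<le> R \<omega>" by (intro AE_I2 order_trans[OF powr_ge_zero R])
    qed
    finally show "(\<integral>\<^sup>+\<omega>. ennreal (norm (y - g *\<^sub>R \<zeta> \<omega>) powr s) \<partial>Q)
        \<le> ennreal ((1 - a / 2 * g) * r powr s + (K1 + C * S) * g powr (s / 2 + 1))"
      using ennreal_leI[OF le] by (rule order_trans)
  qed
qed

lemma square_norm_le_one_plus_powr:
  fixes s :: real
  assumes "s \<ge> 2"
  shows "(norm (z :: 'a::real_normed_vector))\<^sup>2 \<le> 1 + norm z powr s"
proof (cases "norm z \<le> 1")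
  case True
  hence "(norm z)\<^sup>2 \<le> 1" by (simp add: power_le_one)
  thus ?thesis by (smt (verit) powr_ge_zero)
next
  case False
  hence "norm z powr 2 \<le> norm z powr s" using assms by (intro powr_mono) auto
  thus ?thesis using False by (simp add: powr_numeral)
qed

section \<open>The gradient near a regular minimizer\<close>

lemma GDERIV_grad:
  fixes f :: "real ^ 'n \<Rightarrow> real"
  assumes "f differentiable (at x)"
  shows "GDERIV f x :> grad f x"
proof -
  obtain f' where f': "(f has_derivative f') (at x)" using assms by (auto simp: differentiable_def)
  interpret linear f' using f' by (rule has_derivative_linear)
  have "f' = (\<lambda>h. h \<bullet> (\<Sum>b\<in>Basis. f' b *\<^sub>R b))"
  proof
    fix h
    have "f' h = f' (\<Sum>b\<in>Basis. (h \<bullet> b) *\<^sub>R b)" by (simp add: euclidean_representation)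
    also have "\<dots> = (\<Sum>b\<in>Basis. (h \<bullet> b) * f' b)" by (simp add: sum scale)
    finally show "f' h = h \<bullet> (\<Sum>b\<in>Basis. f' b *\<^sub>R b)"
      by (simp add: inner_sum_right mult.commute)
  qed
  hence "GDERIV f x :> (\<Sum>b\<in>Basis. f' b *\<^sub>R b)" using f' unfolding gderiv_def by metis
  moreover have "D = D'" if "GDERIV f x :> D" "GDERIV f x :> D'" for D D'
  proof -
    have "(\<lambda>h. h \<bullet> D) = (\<lambda>h. h \<bullet> D')"
      using that unfolding gderiv_def by (rule has_derivative_unique)
    thus ?thesis by (meson vector_eq_ldot)
  qed
  ultimately show ?thesis unfolding grad_def by (metis (no_types, lifting) theI)
qed

text \<open>Links the gradient to the directional derivatives on which \<^const>\<open>continuously_diff\<close> is based.\<close>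

lemma grad_nth:
  assumes "f differentiable (at x)"
  shows "grad f x $ i = frechet_derivative f (at x) (axis i 1)"
  using frechet_derivative_at[OF GDERIV_grad[OF assms, unfolded gderiv_def]]
  by (metis cart_eq_inner_axis inner_commute)

lemma differentiable_grad:
  assumes "continuously_diff 2 f"
  shows "grad f differentiable (at x)"
proof -
  have f: "f differentiable (at x)" for x
    using assms by (simp add: numeral_2_eq_2)
  have "(\<lambda>x. grad f x $ i) differentiable (at x)" for i
    using assms by (simp add: numeral_2_eq_2 grad_nth[OF f])
  hence "\<forall>b\<in>Basis. (\<lambda>x. grad f x \<bullet> b) differentiable (at x)"
    by (auto simp: Basis_vec_def inner_axis)
  thus ?thesis
    by (subst differentiable_componentwise_within) auto
qed

text \<open>The quadratic form attains its minimum on the unit sphere, and homogeneity extends the bound.\<close>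

lemma pos_def_coercive:
  assumes "pos_def A"
  shows "\<exists>c>0. \<forall>v. c * (norm v)\<^sup>2 \<le> v \<bullet> (A *v v)"
proof -
  have "continuous_on (sphere 0 1) (\<lambda>v. v \<bullet> (A *v v))"
    by (intro continuous_intros linear_continuous_on matrix_vector_mul_bounded_linear)
  moreover have "sphere (0 :: real ^ 'a) 1 \<noteq> {}" by (simp add: sphere_eq_empty)
  ultimately obtain u where u: "norm u = 1" and min: "\<And>v. norm v = 1 \<Longrightarrow> u \<bullet> (A *v u) \<le> v \<bullet> (A *v v)"
    using continuous_attains_inf[of "sphere 0 1" "\<lambda>v. v \<bullet> (A *v v)"] by auto
  have "(u \<bullet> (A *v u)) * (norm v)\<^sup>2 \<le> v \<bullet> (A *v v)" for v
  proof (cases "v = 0")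
    case False
    have "(u \<bullet> (A *v u)) * (norm v)\<^sup>2 \<le> (v /\<^sub>R norm v) \<bullet> (A *v (v /\<^sub>R norm v)) * (norm v)\<^sup>2"
      using False by (intro mult_right_mono min) auto
    also have "\<dots> = v \<bullet> (A *v v)"
      using False by (simp add: matrix_vector_mult_scaleR power2_eq_square field_simps)
    finally show ?thesis .
  qed simp
  moreover have "u \<bullet> (A *v u) > 0" using assms u unfolding pos_def_def by (metis norm_zero zero_neq_one)
  ultimately show ?thesis by blast
qed

text \<open>The gradient vanishes at \<open>xs\<close>, so near \<open>xs\<close> it is \<open>H (x - xs)\<close> up to an error that is at most half
  of the coercivity constant of the Hessian \<open>H\<close> times the distance.\<close>

lemma regular_minimizer_drift:
  fixes f :: "real ^ 'n \<Rightarrow> real"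
  assumes "continuously_diff 2 f" "regular_minimizer f xs"
  shows "\<exists>\<rho>>0. \<exists>a>0. \<exists>L>0. \<forall>x\<in>ball xs \<rho>. a * (norm (x - xs))\<^sup>2 \<le> grad f x \<bullet> (x - xs)
    \<and> norm (grad f x) \<le> L * norm (x - xs)"
proof -
  obtain N where N: "open N" "xs \<in> N" "\<forall>y\<in>N. f xs \<le> f y"
    using assms(2) unfolding regular_minimizer_def eventually_nhds by auto
  have "f differentiable (at xs)" using assms(1) by (simp add: numeral_2_eq_2)
  hence "(\<lambda>h. h \<bullet> grad f xs) = (\<lambda>h. 0)"
    using N GDERIV_grad unfolding gderiv_def by (intro differential_zero_maxmin[of xs N f]) auto
  hence zero: "grad f xs = 0" by (metis inner_eq_zero_iff)
  define H where "H = hessian f xs"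
  obtain c where c: "c > 0" "\<And>v. c * (norm v)\<^sup>2 \<le> v \<bullet> (H *v v)"
    using pos_def_coercive assms(2) unfolding regular_minimizer_def H_def by blast
  have "(grad f has_derivative (*v) H) (at xs)"
    using differentiable_grad[OF assms(1)] jacobian_works[of "grad f" "at xs"]
    by (simp add: H_def hessian_def)
  then obtain B where B: "B > 0" "\<And>v. norm (H *v v) \<le> norm v * B"
    using bounded_linear.pos_bounded has_derivative_bounded_linear by blast
  obtain \<rho> where \<rho>: "\<rho> > 0"
    "\<And>x. norm (x - xs) < \<rho> \<Longrightarrow> norm (grad f x - H *v (x - xs)) \<le> c / 2 * norm (x - xs)"
    using \<open>(grad f has_derivative (*v) H) (at xs)\<close> c(1) zero
    unfolding has_derivative_at_alt by (metis diff_zero half_gt_zero)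
  have "c / 2 * (norm (x - xs))\<^sup>2 \<le> grad f x \<bullet> (x - xs) \<and> norm (grad f x) \<le> (B + c / 2) * norm (x - xs)"
    if "x \<in> ball xs \<rho>" for x
  proof
    define v where "v = x - xs"
    define e where "e = grad f x - H *v v"
    have e: "norm e \<le> c / 2 * norm v"
      using \<rho>(2)[of x] that by (simp add: e_def v_def dist_norm norm_minus_commute)
    have "\<bar>e \<bullet> v\<bar> \<le> c / 2 * norm v * norm v"
      using Cauchy_Schwarz_ineq2[of e v] e mult_right_mono[OF e, of "norm v"] by simp
    moreover have "grad f x \<bullet> v = v \<bullet> (H *v v) + e \<bullet> v"
      by (simp add: e_def inner_diff_left inner_commute[of "H *v v"])
    ultimately show "c / 2 * (norm (x - xs))\<^sup>2 \<le> grad f x \<bullet> (x - xs)"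
      using c(2)[of v] by (simp add: power2_eq_square flip: v_def)
    have "norm (grad f x) \<le> norm (H *v v) + norm e"
      using norm_triangle_ineq[of "H *v v" e] by (simp add: e_def)
    thus "norm (grad f x) \<le> (B + c / 2) * norm (x - xs)"
      using B(2)[of v] e by (simp add: algebra_simps flip: v_def)
  qed
  thus ?thesis using \<rho>(1) c(1) B(1) by (intro exI[of _ \<rho>] exI[of _ "c / 2"] exI[of _ "B + c / 2"] conjI) auto
qed

lemma norm_gradient_step_le:
  assumes "a * (norm (x - xs))\<^sup>2 \<le> G \<bullet> (x - xs)" "norm G \<le> L * norm (x - xs)"
    and g: "0 \<le> g" "g * L\<^sup>2 \<le> a"
  shows "(norm (x - xs - g *\<^sub>R G))\<^sup>2 \<le> (1 - a * g) * (norm (x - xs))\<^sup>2"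
proof -
  have "(norm G)\<^sup>2 \<le> (L * norm (x - xs))\<^sup>2" using assms(2) by (intro power_mono) auto
  hence "g * (norm G)\<^sup>2 \<le> g * (L * norm (x - xs))\<^sup>2" using g by (intro mult_left_mono)
  also have "\<dots> = (g * L\<^sup>2) * (norm (x - xs))\<^sup>2" by (simp add: power_mult_distrib)
  also have "\<dots> \<le> a * (norm (x - xs))\<^sup>2" using g by (intro mult_right_mono) auto
  finally have "g * (g * (norm G)\<^sup>2) \<le> g * (a * (norm (x - xs))\<^sup>2)"
    using g by (intro mult_left_mono)
  moreover have "g * (a * (norm (x - xs))\<^sup>2) \<le> g * (G \<bullet> (x - xs))"
    using assms(1) g by (intro mult_left_mono)
  moreover have "(norm (v - g *\<^sub>R G))\<^sup>2 = (norm v)\<^sup>2 - 2 * (g * (G \<bullet> v)) + g * (g * (norm G)\<^sup>2)" for v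
    unfolding power2_norm_eq_inner
    by (simp add: inner_diff_left inner_diff_right inner_commute[of v G] right_diff_distrib)
  note this[of "x - xs"]
  moreover have "(1 - a * g) * (norm (x - xs))\<^sup>2 = (norm (x - xs))\<^sup>2 - g * (a * (norm (x - xs))\<^sup>2)"
    by (simp add: left_diff_distrib)
  ultimately show ?thesis by linarith
qed

section \<open>Independence of the seed from the past\<close>

text \<open>A substitute for conditioning on the past: \<open>N\<close> carries the \<open>\<sigma>\<close>-algebra of the past and the seed
  \<open>W\<close> is independent of it, so the pair \<open>(s, W s)\<close> has the product law on \<open>N \<Otimes> P\<close> and Tonelli's theorem
  allows the seed to be integrated first.\<close>

lemma nn_integral_independent_seed:
  assumes "prob_space M" and N: "space N = space M" "sets N \<subseteq> sets M"
    and W: "W \<in> measurable M P" "distr M P W = P" and "prob_space P"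
    and ind: "prob_space.indep_set M (sets N) {W -` B \<inter> space M | B. B \<in> sets P}"
    and h: "h \<in> borel_measurable (N \<Otimes>\<^sub>M P)"
  shows "(\<integral>\<^sup>+s. h (s, W s) \<partial>M) = (\<integral>\<^sup>+s. (\<integral>\<^sup>+w. h (s, w) \<partial>P) \<partial>M)"
proof -
  interpret prob_space M by fact
  interpret P: prob_space P by fact
  have id: "(\<lambda>s. s) \<in> measurable M N"
    using N(2) sets.sets_into_space[of _ N] by (intro measurableI) (auto simp: Int_absorb2 N(1))
  have meas: "(\<lambda>s. (s, W s)) \<in> measurable M (N \<Otimes>\<^sub>M P)"
    using id W(1) by auto
  interpret N: prob_space "distr M N (\<lambda>s. s)" by (rule prob_space_distr[OF id])
  have joint: "distr M N (\<lambda>s. s) \<Otimes>\<^sub>M P = distr M (N \<Otimes>\<^sub>M P) (\<lambda>s. (s, W s))"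
  proof (rule pair_measure_eqI)
    show "sigma_finite_measure (distr M N (\<lambda>s. s))" "sigma_finite_measure P" by unfold_locales
    fix A B assume A: "A \<in> sets (distr M N (\<lambda>s. s))" and B: "B \<in> sets P"
    have A': "A \<inter> space M = A" using A sets.sets_into_space[of A N] by (auto simp: N(1))
    have "(\<lambda>s. (s, W s)) -` (A \<times> B) \<inter> space M = A \<inter> (W -` B \<inter> space M)"
      using A' by auto
    moreover have "prob (A \<inter> (W -` B \<inter> space M)) = prob A * prob (W -` B \<inter> space M)"
      using A B by (intro indep_setD[OF ind]) auto
    moreover have "emeasure P B = emeasure M (W -` B \<inter> space M)"
      using B by (subst W(2)[symmetric]) (rule emeasure_distr[OF W(1)])
    ultimately show "emeasure (distr M N (\<lambda>s. s)) A * emeasure P B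
        = emeasure (distr M (N \<Otimes>\<^sub>M P) (\<lambda>s. (s, W s))) (A \<times> B)"
      using A B A' by (simp add: emeasure_distr[OF id] emeasure_distr[OF meas] emeasure_eq_measure ennreal_mult)
  qed (simp cong: sets_pair_measure_cong)
  have h': "h \<in> borel_measurable (distr M N (\<lambda>s. s) \<Otimes>\<^sub>M P)"
    using h by (simp cong: measurable_cong_sets)
  have "(\<integral>\<^sup>+s. h (s, W s) \<partial>M) = (\<integral>\<^sup>+x. h x \<partial>distr M (N \<Otimes>\<^sub>M P) (\<lambda>s. (s, W s)))"
    using h by (intro nn_integral_distr[OF meas, symmetric]) simp
  also have "\<dots> = (\<integral>\<^sup>+s. (\<integral>\<^sup>+w. h (s, w) \<partial>P) \<partial>distr M N (\<lambda>s. s))"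
    unfolding joint[symmetric] by (rule P.nn_integral_fst[OF h', symmetric])
  also have "\<dots> = (\<integral>\<^sup>+s. (\<integral>\<^sup>+w. h (s, w) \<partial>P) \<partial>M)"
    using P.borel_measurable_nn_integral_fst[OF h] by (intro nn_integral_distr[OF id]) simp
  finally show ?thesis .
qed

section \<open>Recursions with polynomially decaying step sizes\<close>

lemma powr_add_one_le:
  fixes t p :: real
  assumes "t > 0" "0 \<le> p" "p \<le> 1"
  shows "(t + 1) powr p \<le> t powr p + 1"
proof -
  have "(t + 1) powr p = (t + 1) * (t + 1) powr (p - 1)"
    using assms by (simp add: powr_diff)
  also have "\<dots> = t * (t + 1) powr (p - 1) + (t + 1) powr (p - 1)"
    by (simp add: algebra_simps)
  also have "\<dots> \<le> t * t powr (p - 1) + 1 powr (p - 1)"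
    using assms by (intro add_mono mult_left_mono powr_mono2') auto
  also have "\<dots> = t powr p + 1"
    using assms by (simp add: powr_diff)
  finally show ?thesis .
qed

text \<open>A recursion of Chung type. With \<open>A = (n + m)\<^sup>p\<close>, the bound \<open>C/A\<close> reproduces itself: the contraction
  gains \<open>2 C/A\<^sup>2\<close>, the noise costs at most \<open>C/A\<^sup>2\<close>, and the remaining gain \<open>C/A\<^sup>2\<close> is enough to pass from \<open>C/A\<close> to
  \<open>C/(A + 1)\<close>, which suffices because \<open>(n + 1 + m)\<^sup>p \<le> A + 1\<close> for \<open>p \<le> 1\<close>.\<close>

lemma chung_recursion_bound:
  fixes u :: "nat \<Rightarrow> real" and b p m \<gamma> k :: real
  assumes p: "0 \<le> p" "p \<le> 1" and m: "0 \<le> m" and \<gamma>: "b * \<gamma> \<ge> 2"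
    and small: "\<And>n. n \<ge> 1 \<Longrightarrow> b * (\<gamma> / (real n + m) powr p) \<le> 1"
    and rec: "\<And>n. n \<ge> 1 \<Longrightarrow> u (Suc n) \<le> (1 - b * (\<gamma> / (real n + m) powr p)) * u n
                  + k * (\<gamma> / (real n + m) powr p)\<^sup>2"
  shows "\<exists>C\<ge>0. \<forall>n\<ge>1. u n \<le> C / (real n + m) powr p"
proof -
  define C where "C = max 0 (max (k * \<gamma>\<^sup>2) (u 1 * (1 + m) powr p))"
  have C: "C \<ge> 0" "C \<ge> k * \<gamma>\<^sup>2" "C \<ge> u 1 * (1 + m) powr p" by (auto simp: C_def)
  have "u n \<le> C / (real n + m) powr p" if "n \<ge> 1" for n
    using that
  proof (induction n rule: dec_induct)
    case base
    thus ?case using C(3) m by (simp add: field_simps)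
  next
    case (step n)
    define A where "A = (real n + m) powr p"
    have n: "real n \<ge> 1" using step by simp
    have A: "A > 0" using n m by (simp add: A_def)
    have "u (Suc n) \<le> (1 - b * (\<gamma> / A)) * u n + k * (\<gamma> / A)\<^sup>2"
      using rec step by (simp add: A_def)
    also have "\<dots> \<le> (1 - b * (\<gamma> / A)) * (C / A) + k * (\<gamma> / A)\<^sup>2"
      using step.IH small[of n] step.hyps
      by (intro add_right_mono mult_left_mono) (auto simp: A_def)
    also have "\<dots> = C / A - (b * \<gamma>) * C / A\<^sup>2 + k * \<gamma>\<^sup>2 / A\<^sup>2"
      using A by (simp add: field_simps power2_eq_square)
    also have "\<dots> \<le> C / A - 2 * C / A\<^sup>2 + C / A\<^sup>2"
      using C \<gamma> A by (intro add_mono diff_mono divide_right_mono mult_right_mono) auto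
    also have "\<dots> = C * ((A - 1) / A\<^sup>2)"
      using A by (simp add: field_simps power2_eq_square)
    also have "\<dots> \<le> C * (1 / (A + 1))"
    proof (rule mult_left_mono[OF _ C(1)])
      have "(A - 1) * (A + 1) \<le> A\<^sup>2" by (simp add: algebra_simps power2_eq_square)
      thus "(A - 1) / A\<^sup>2 \<le> 1 / (A + 1)" using A by (simp add: divide_simps mult.commute)
    qed
    also have "\<dots> \<le> C * (1 / (real (Suc n) + m) powr p)"
    proof (intro mult_left_mono C(1) divide_left_mono)
      show "(real (Suc n) + m) powr p \<le> A + 1"
        using powr_add_one_le[of "real n + m" p] n m p by (simp add: A_def add_ac)
      show "0 < (A + 1) * (real (Suc n) + m) powr p" using A m by simp
    qed auto
    finally show ?case by simp
  qed
  thus ?thesis using C(1) by blast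
qed

text \<open>As \<open>n + m\<close> is at least \<open>n\<close> and at least \<open>m\<close>, part of the exponent can be spent on \<open>m\<close> to obtain a
  factor that tends to zero, leaving a convergent series in \<open>n\<close>.\<close>

lemma shifted_powr_sums_vanish:
  fixes \<beta> \<epsilon> :: real
  assumes "\<beta> > 1" "\<epsilon> > 0"
  shows "\<forall>\<^sub>F m in at_top. \<forall>N. (\<Sum>n = 1..<N. (real n + m) powr (- \<beta>)) \<le> \<epsilon>"
proof -
  define \<theta> where "\<theta> = (\<beta> - 1) / 2"
  have \<theta>: "\<theta> > 0" "\<beta> - \<theta> > 1" using assms by (simp_all add: \<theta>_def field_simps)
  define T where "T = (\<Sum>n. real n powr (- (\<beta> - \<theta>)))"
  have sm: "summable (\<lambda>n. real n powr (- (\<beta> - \<theta>)))"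
    using \<theta> by (subst summable_real_powr_iff) auto
  have "- \<theta> < 0" using \<theta> by simp
  from tendsto_mult[OF tendsto_neg_powr[OF this filterlim_ident] tendsto_const[of T]]
  have "((\<lambda>m. m powr (- \<theta>) * T) \<longlongrightarrow> 0 * T) at_top" .
  hence "\<forall>\<^sub>F m in at_top. m powr (- \<theta>) * T < \<epsilon>"
    using assms by (auto dest: order_tendstoD(2))
  moreover have "\<forall>\<^sub>F m in at_top. m > (0::real)" by (rule eventually_gt_at_top)
  ultimately show ?thesis
  proof eventually_elim
    case (elim m)
    show ?case
    proof
      fix N
      have "(\<Sum>n = 1..<N. (real n + m) powr (- \<beta>)) \<le> (\<Sum>n = 1..<N. m powr (- \<theta>) * real n powr (- (\<beta> - \<theta>)))"
      proof (rule sum_mono)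
        fix n assume n: "n \<in> {1..<N}"
        have "(real n + m) powr (- \<beta>) = (real n + m) powr (- \<theta>) * (real n + m) powr (- (\<beta> - \<theta>))"
          by (simp flip: powr_add)
        also have "\<dots> \<le> m powr (- \<theta>) * real n powr (- (\<beta> - \<theta>))"
          using n elim \<theta> by (intro mult_mono powr_mono2') auto
        finally show "(real n + m) powr (- \<beta>) \<le> m powr (- \<theta>) * real n powr (- (\<beta> - \<theta>))" .
      qed
      also have "\<dots> = m powr (- \<theta>) * (\<Sum>n = 1..<N. real n powr (- (\<beta> - \<theta>)))"
        by (simp add: sum_distrib_left)
      also have "\<dots> \<le> m powr (- \<theta>) * T"
        unfolding T_def by (intro mult_left_mono sum_le_suminf sm) auto
      finally show "(\<Sum>n = 1..<N. (real n + m) powr (- \<beta>)) \<le> \<epsilon>" using elim by linarith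
    qed
  qed
qed

section \<open>Moments of a run before it leaves the ball\<close>

definition stay_until ::
    "'s measure \<Rightarrow> (nat \<Rightarrow> 's \<Rightarrow> real ^ 'n) \<Rightarrow> (real ^ 'n) set \<Rightarrow> nat \<Rightarrow> 's set" where
  "stay_until M X U n = {s \<in> space M. \<forall>i\<in>{1..n}. X i s \<in> U}"

abbreviation stopped_moment where
  "stopped_moment M X xs U s n \<equiv> (\<integral>\<omega>. indicator (stay_until M X U n) \<omega> * norm (X n \<omega> - xs) powr s \<partial>M)"

lemma stay_until_Suc_subset: "stay_until M X U (Suc n) \<subseteq> stay_until M X U n"
  by (auto simp: stay_until_def)

text \<open>The measure \<open>N\<close> may carry a smaller \<open>\<sigma>\<close>-algebra than \<open>M\<close>: the event belongs to the past up to time \<open>n\<close>,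
  which is what makes it independent of the next seed.\<close>

lemma sets_stay_until:
  assumes "space N = space M" "\<And>i. i \<in> {1..n} \<Longrightarrow> X i \<in> borel_measurable N" "U \<in> sets borel"
  shows "stay_until M X U n \<in> sets N"
  unfolding stay_until_def assms(1)[symmetric]
proof (rule sets.sets_Collect_finite_All)
  fix i assume "i \<in> {1..n}"
  hence "X i -` U \<inter> space N \<in> sets N" using assms by (intro measurable_sets) auto
  thus "{s \<in> space N. X i s \<in> U} \<in> sets N" by (simp add: vimage_def Int_def conj_commute)
qed simp

lemma integrable_stopped_moment:
  assumes "prob_space M" "\<And>i. i \<ge> 1 \<Longrightarrow> X i \<in> borel_measurable M" "n \<ge> 1" "0 \<le> s"
  shows "integrable M (\<lambda>\<omega>. indicator (stay_until M X (ball xs \<rho>) n) \<omega> * norm (X n \<omega> - xs) powr s)"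
proof -
  interpret prob_space M by fact
  have [measurable]: "stay_until M X (ball xs \<rho>) n \<in> sets M"
    by (rule sets_stay_until) (auto simp: assms)
  have [measurable]: "X n \<in> borel_measurable M" using assms by auto
  show ?thesis
  proof (rule integrable_const_bound[of _ "\<rho> powr s"])
    show "AE \<omega> in M. norm (indicator (stay_until M X (ball xs \<rho>) n) \<omega> * norm (X n \<omega> - xs) powr s) \<le> \<rho> powr s"
      using assms(3,4) by (intro AE_I2)
        (auto simp: stay_until_def dist_norm norm_minus_commute less_imp_le indicator_def intro!: powr_mono2)
  qed measurable
qed

text \<open>Transfers a one-step bound, stated for each deterministic point of the ball, to the run. The event
  that the run has stayed in the ball until time \<open>n\<close> and the iterate \<open>X\<^sub>n\<close> are functions of the past, whereas the seed
  is fresh.\<close>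

lemma sgd_stopped_moment_step:
  fixes f :: "real ^ 'n \<Rightarrow> real" and P :: "'w measure" and M :: "'s measure" and step :: "nat \<Rightarrow> real"
  assumes run: "sgd_run f P Z step M X W" and P: "prob_space P"
    and Z: "(\<lambda>(x, \<omega>). Z x \<omega>) \<in> borel_measurable (borel \<Otimes>\<^sub>M P)"
    and f: "continuous_on UNIV (grad f)"
    and n: "n \<ge> 1" and s: "0 \<le> s" and c: "0 \<le> c" and k: "0 \<le> k"
    and one_step: "\<And>x. x \<in> ball xs \<rho> \<Longrightarrow>
      (\<integral>\<^sup>+\<omega>. ennreal (norm (x - step n *\<^sub>R sgd_oracle f Z x \<omega> - xs) powr s) \<partial>P)
        \<le> ennreal (c * norm (x - xs) powr s + k)"
  shows "integrable M (\<lambda>\<omega>. indicator (stay_until M X (ball xs \<rho>) n) \<omega> * norm (X (Suc n) \<omega> - xs) powr s)"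
    and "(\<integral>\<omega>. indicator (stay_until M X (ball xs \<rho>) n) \<omega> * norm (X (Suc n) \<omega> - xs) powr s \<partial>M)
      \<le> c * stopped_moment M X xs (ball xs \<rho>) s n + k"
proof -
  define E where "E = stay_until M X (ball xs \<rho>) n"
  interpret prob_space M using run by (simp add: sgd_run_def)
  have X: "\<And>i. i \<ge> 1 \<Longrightarrow> X i \<in> borel_measurable M"
    and W: "W n \<in> measurable M P" "distr M P (W n) = P"
    and ind: "indep_set (natural_filtration M X n) {W n -` B \<inter> space M | B. B \<in> sets P}"
    and XS: "\<And>\<omega>. \<omega> \<in> space M \<Longrightarrow> X (Suc n) \<omega> = X n \<omega> - step n *\<^sub>R sgd_oracle f Z (X n \<omega>) (W n \<omega>)"
    using run n unfolding sgd_run_def by auto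
  define G where "G = (\<Union>i\<in>{1..n}. {X i -` B \<inter> space M | B. B \<in> sets (borel :: (real ^ 'n) measure)})"
  \<comment> \<open>\<open>N\<close> is \<open>M\<close>'s sample space with the natural filtration at time \<open>n\<close> as its \<open>\<sigma>\<close>-algebra.\<close>
  define N where "N = sigma (space M) G"
  have G: "G \<subseteq> sets M" using X by (auto simp: G_def intro!: measurable_sets)
  hence Gp: "G \<subseteq> Pow (space M)" using sets.sets_into_space by blast
  have spN: "space N = space M" using Gp by (simp add: N_def space_measure_of_conv)
  have sN: "sets N = natural_filtration M X n"
    using Gp by (simp add: N_def natural_filtration_def G_def)
  have sNM: "sets N \<subseteq> sets M" unfolding N_def using Gp G
    by (simp add: sets.sigma_sets_subset)
  have XN: "X i \<in> borel_measurable N" if "i \<in> {1..n}" for i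
  proof (rule measurableI)
    fix B :: "(real ^ 'n) set" assume "B \<in> sets borel"
    hence "X i -` B \<inter> space M \<in> G" using that unfolding G_def by blast
    thus "X i -` B \<inter> space N \<in> sets N" unfolding spN unfolding N_def using Gp by auto
  qed simp
  have EN [measurable]: "E \<in> sets N" unfolding E_def using XN spN by (intro sets_stay_until) auto
  have [measurable]: "X n \<in> borel_measurable N" using XN n by auto
  have [measurable]: "grad f \<in> borel_measurable borel" using f by (rule borel_measurable_continuous_onI)
  have "(\<lambda>z. (X n (fst z), snd z)) \<in> measurable (N \<Otimes>\<^sub>M P) (borel \<Otimes>\<^sub>M P)" by measurable
  from measurable_compose[OF this Z]
  have [measurable]: "(\<lambda>z. Z (X n (fst z)) (snd z)) \<in> borel_measurable (N \<Otimes>\<^sub>M P)" by simp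
  define h where "h = (\<lambda>z. ennreal (indicator E (fst z) *
    norm (X n (fst z) - step n *\<^sub>R (grad f (X n (fst z)) + Z (X n (fst z)) (snd z)) - xs) powr s))"
  have h: "h \<in> borel_measurable (N \<Otimes>\<^sub>M P)" unfolding h_def by measurable
  have EM [measurable]: "E \<in> sets M" using EN sNM by auto
  have [measurable]: "X n \<in> borel_measurable M" "X (Suc n) \<in> borel_measurable M" using X n by auto
  define D where "D = (\<lambda>\<omega>. indicator E \<omega> * norm (X (Suc n) \<omega> - xs) powr s)"
  have iEn: "integrable M (\<lambda>\<omega>. indicator E \<omega> * norm (X n \<omega> - xs) powr s)"
    unfolding E_def using X n s by (intro integrable_stopped_moment) (auto intro: prob_space_axioms)
  have iE: "integrable M (indicator E :: 's \<Rightarrow> real)" by (simp add: integrable_indicator_iff emeasure_eq_measure)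
  have "(\<integral>\<^sup>+\<omega>. ennreal (D \<omega>) \<partial>M) = (\<integral>\<^sup>+\<omega>. h (\<omega>, W n \<omega>) \<partial>M)"
    by (intro nn_integral_cong) (simp add: h_def D_def XS sgd_oracle_def)
  also have "\<dots> = (\<integral>\<^sup>+\<omega>. (\<integral>\<^sup>+w. h (\<omega>, w) \<partial>P) \<partial>M)"
    using ind by (intro nn_integral_independent_seed[OF _ spN sNM W P _ h]) (auto simp: sN intro: prob_space_axioms)
  also have "\<dots> \<le> (\<integral>\<^sup>+\<omega>. ennreal (c * (indicator E \<omega> * norm (X n \<omega> - xs) powr s) + k * indicator E \<omega>) \<partial>M)"
  proof (rule nn_integral_mono)
    fix \<omega> assume "\<omega> \<in> space M"
    show "(\<integral>\<^sup>+w. h (\<omega>, w) \<partial>P) \<le> ennreal (c * (indicator E \<omega> * norm (X n \<omega> - xs) powr s) + k * indicator E \<omega>)"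
    proof (cases "\<omega> \<in> E")
      case True
      hence "X n \<omega> \<in> ball xs \<rho>" using n by (auto simp: E_def stay_until_def)
      from one_step[OF this] True show ?thesis by (simp add: h_def sgd_oracle_def)
    qed (simp add: h_def)
  qed
  also have "\<dots> = ennreal (\<integral>\<omega>. c * (indicator E \<omega> * norm (X n \<omega> - xs) powr s) + k * indicator E \<omega> \<partial>M)"
    using iEn iE c k by (intro nn_integral_eq_integral) auto
  also have "(\<integral>\<omega>. c * (indicator E \<omega> * norm (X n \<omega> - xs) powr s) + k * indicator E \<omega> \<partial>M)
      = c * stopped_moment M X xs (ball xs \<rho>) s n + k * prob E"
    using iEn iE by (simp add: E_def[symmetric])
  finally have le: "(\<integral>\<^sup>+\<omega>. ennreal (D \<omega>) \<partial>M)
      \<le> ennreal (c * stopped_moment M X xs (ball xs \<rho>) s n + k * prob E)" .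
  have [measurable]: "D \<in> borel_measurable M" unfolding D_def by measurable
  have D0: "D \<omega> \<ge> 0" for \<omega> by (simp add: D_def)
  have iD: "integrable M D"
    using le D0 by (intro integrableI_bounded) (auto simp: le_less_trans)
  thus "integrable M (\<lambda>\<omega>. indicator (stay_until M X (ball xs \<rho>) n) \<omega> * norm (X (Suc n) \<omega> - xs) powr s)"
    by (simp add: D_def E_def)
  have "0 \<le> stopped_moment M X xs (ball xs \<rho>) s n" by (intro Bochner_Integration.integral_nonneg) simp
  hence "(\<integral>\<omega>. D \<omega> \<partial>M) \<le> c * stopped_moment M X xs (ball xs \<rho>) s n + k * prob E"
    using le c k D0
    by (subst (asm) nn_integral_eq_integral[OF iD]) (auto simp: ennreal_le_iff simp del: ennreal_plus)
  also have "\<dots> \<le> c * stopped_moment M X xs (ball xs \<rho>) s n + k"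
    using k by (simp add: mult_left_le)
  finally show "(\<integral>\<omega>. indicator (stay_until M X (ball xs \<rho>) n) \<omega> * norm (X (Suc n) \<omega> - xs) powr s \<partial>M)
      \<le> c * stopped_moment M X xs (ball xs \<rho>) s n + k"
    by (simp add: D_def E_def)
qed

section \<open>Exit probability, conditioning and the oracle moments\<close>

lemma stay_event_eq_Inter: "stay_event M X U = (\<Inter>n. stay_until M X U n)"
  by (fastforce simp: stay_event_def stay_until_def)

text \<open>A maximal inequality by bookkeeping. On the event that the run first leaves the ball at time \<open>n + 1\<close>,
  the new distance is at least \<open>\<rho>\<close>, so restricting the moment from \<open>E n\<close> to \<open>E (n + 1)\<close> releases at least
  \<open>\<rho>\<^sup>s\<close> times the probability of that exit. Telescoping bounds the total exit probability.\<close>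

lemma prob_stay_event_ge:
  fixes M :: "'s measure" and X :: "nat \<Rightarrow> 's \<Rightarrow> real ^ 'n" and xs :: "real ^ 'n" and \<rho> \<eta> s :: real
  defines "E \<equiv> stay_until M X (ball xs \<rho>)"
  assumes M: "prob_space M" and X: "\<And>i. i \<ge> 1 \<Longrightarrow> X i \<in> borel_measurable M"
    and \<rho>: "\<rho> > 0" and s: "0 \<le> s"
    and X1: "AE \<omega> in M. X 1 \<omega> \<in> ball xs \<rho>"
    and int: "\<And>n. n \<ge> 1 \<Longrightarrow> integrable M (\<lambda>\<omega>. indicator (E n) \<omega> * norm (X (Suc n) \<omega> - xs) powr s)"
    and rec: "\<And>n. n \<ge> 1 \<Longrightarrow> (\<integral>\<omega>. indicator (E n) \<omega> * norm (X (Suc n) \<omega> - xs) powr s \<partial>M)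
        \<le> stopped_moment M X xs (ball xs \<rho>) s n + k n"
    and sums: "\<And>N. stopped_moment M X xs (ball xs \<rho>) s 1 + (\<Sum>n = 1..<N. k n) \<le> \<eta> * \<rho> powr s"
  shows "measure M (stay_event M X (ball xs \<rho>)) \<ge> 1 - \<eta>"
proof -
  interpret prob_space M by fact
  have E [measurable]: "E n \<in> sets M" for n
    unfolding E_def using X by (intro sets_stay_until) auto
  define F where "F n = stopped_moment M X xs (ball xs \<rho>) s n" for n
  have iF: "integrable M (\<lambda>\<omega>. indicator (E n) \<omega> * norm (X n \<omega> - xs) powr s)" if "n \<ge> 1" for n
    unfolding E_def using X that s M by (intro integrable_stopped_moment)
  have iE: "integrable M (indicator (E n) :: 's \<Rightarrow> real)" for n
    by (simp add: integrable_indicator_iff emeasure_eq_measure)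
  have exit: "F (Suc n) + \<rho> powr s * (prob (E n) - prob (E (Suc n))) \<le> F n + k n" if "n \<ge> 1" for n
  proof -
    have "F (Suc n) + \<rho> powr s * (prob (E n) - prob (E (Suc n)))
      = (\<integral>\<omega>. indicator (E (Suc n)) \<omega> * norm (X (Suc n) \<omega> - xs) powr s
            + \<rho> powr s * (indicator (E n) \<omega> - indicator (E (Suc n)) \<omega>) \<partial>M)"
      using iF[of "Suc n"] iE by (simp add: F_def E_def[symmetric])
    also have "\<dots> \<le> (\<integral>\<omega>. indicator (E n) \<omega> * norm (X (Suc n) \<omega> - xs) powr s \<partial>M)"
    proof (rule integral_mono)
      fix \<omega> assume \<omega>: "\<omega> \<in> space M"
      show "indicator (E (Suc n)) \<omega> * norm (X (Suc n) \<omega> - xs) powr s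
            + \<rho> powr s * (indicator (E n) \<omega> - indicator (E (Suc n)) \<omega>)
          \<le> indicator (E n) \<omega> * norm (X (Suc n) \<omega> - xs) powr s"
      proof (cases "\<omega> \<in> E n \<and> \<omega> \<notin> E (Suc n)")
        case True
        hence "\<not> X (Suc n) \<omega> \<in> ball xs \<rho>" using \<omega> by (auto simp: E_def stay_until_def le_Suc_eq)
        hence "\<rho> \<le> norm (X (Suc n) \<omega> - xs)" by (simp add: dist_norm norm_minus_commute)
        hence "\<rho> powr s \<le> norm (X (Suc n) \<omega> - xs) powr s" using \<rho> s by (intro powr_mono2) auto
        thus ?thesis using True by simp
      next
        case False
        thus ?thesis using stay_until_Suc_subset[of M X "ball xs \<rho>" n]
          by (auto simp: E_def indicator_def)
      qed
    qed (use iF[of "Suc n"] iE int that in auto)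
    also have "\<dots> \<le> F n + k n" using rec[OF that] by (simp add: F_def)
    finally show ?thesis .
  qed
  have acc: "F N + \<rho> powr s * (prob (E 1) - prob (E N)) \<le> F 1 + (\<Sum>n = 1..<N. k n)" if "N \<ge> 1" for N
    using that
  proof (induction N rule: dec_induct)
    case (step N)
    thus ?case using exit[of N] by (simp add: algebra_simps)
  qed simp
  have "AE \<omega> in M. \<omega> \<in> E 1"
    using X1 AE_space by eventually_elim (simp add: E_def stay_until_def)
  hence "prob (E 1) = 1" by (simp only: prob_eq_1[OF E])
  moreover have "F N \<ge> 0" for N unfolding F_def by (intro Bochner_Integration.integral_nonneg) simp
  ultimately have "\<rho> powr s * (1 - prob (E N)) \<le> \<rho> powr s * \<eta>" if "N \<ge> 1" for N
    using acc[OF that] sums[of N] F_def[of 1] by (smt (verit) mult.commute)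
  hence lower: "1 - \<eta> \<le> prob (E N)" if "N \<ge> 1" for N
    using \<rho> that by (smt (verit) mult_le_cancel_left_pos powr_gt_zero)
  have "(\<lambda>n. prob (E n)) \<longlonglongrightarrow> prob (\<Inter>n. E n)"
    using E by (intro finite_Lim_measure_decseq decseq_SucI) (auto simp: E_def intro: subsetD[OF stay_until_Suc_subset])
  from LIMSEQ_le_const[OF this] lower show ?thesis
    unfolding stay_event_eq_Inter E_def by blast
qed

text \<open>Conditioning on \<open>A\<close> multiplies the integrand on \<open>A\<close> by \<open>1 / prob A \<le> 2\<close>; the superset \<open>B\<close> is there because moment
  bounds are available for the events of staying up to a finite time only.\<close>

lemma uniform_measure_integral_le:
  fixes h :: "'s \<Rightarrow> real"
  assumes "prob_space M" "A \<in> sets M" "A \<subseteq> B" "measure M A \<ge> 1 / 2"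
    and h: "h \<in> borel_measurable M" "\<And>\<omega>. 0 \<le> h \<omega>"
    and int: "integrable M (\<lambda>\<omega>. indicator B \<omega> * h \<omega>)"
  shows "integrable (uniform_measure M A) h"
    and "(\<integral>\<omega>. h \<omega> \<partial>uniform_measure M A) \<le> 2 * (\<integral>\<omega>. indicator B \<omega> * h \<omega> \<partial>M)"
proof -
  interpret prob_space M by fact
  have [measurable]: "A \<in> sets M" "h \<in> borel_measurable M" by fact+
  define d where "d \<omega> = indicator A \<omega> / prob A" for \<omega>
  have um: "uniform_measure M A = density M (\<lambda>\<omega>. ennreal (d \<omega>))"
    unfolding uniform_measure_def using assms(4)
    by (intro arg_cong[where f = "density M"] ext)
      (auto simp: d_def emeasure_eq_measure divide_ennreal indicator_def simp flip: ennreal_1)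
  have le: "d \<omega> * h \<omega> \<le> 2 * (indicator B \<omega> * h \<omega>)" for \<omega>
  proof (cases "\<omega> \<in> A")
    case True
    have "1 / prob A * h \<omega> \<le> 2 * h \<omega>"
      using assms(4) h(2) by (intro mult_right_mono) (auto simp: divide_simps)
    thus ?thesis using True assms(3) by (auto simp: d_def)
  qed (use h(2) in \<open>simp add: d_def\<close>)
  have d0: "d \<omega> \<ge> 0" for \<omega> by (simp add: d_def)
  have [measurable]: "d \<in> borel_measurable M" unfolding d_def by measurable
  have i: "integrable M (\<lambda>\<omega>. d \<omega> * h \<omega>)"
  proof (rule Bochner_Integration.integrable_bound[OF integrable_mult_right[OF int, of 2]])
    show "AE \<omega> in M. norm (d \<omega> * h \<omega>) \<le> norm (2 * (indicator B \<omega> * h \<omega>))"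
      using le d0 h(2) by (intro AE_I2) (simp add: abs_mult abs_of_nonneg)
  qed measurable
  thus "integrable (uniform_measure M A) h"
    unfolding um using d0 by (subst integrable_density) auto
  have "(\<integral>\<omega>. h \<omega> \<partial>uniform_measure M A) = (\<integral>\<omega>. d \<omega> * h \<omega> \<partial>M)"
    unfolding um using d0 by (subst integral_density) auto
  also have "\<dots> \<le> (\<integral>\<omega>. 2 * (indicator B \<omega> * h \<omega>) \<partial>M)"
    using i int le by (intro integral_mono) auto
  finally show "(\<integral>\<omega>. h \<omega> \<partial>uniform_measure M A) \<le> 2 * (\<integral>\<omega>. indicator B \<omega> * h \<omega> \<partial>M)" by simp
qed

text \<open>For \<open>q = \<infinity>\<close> the error is almost surely bounded, so it satisfies the moment bound for every finite
  exponent, and \<open>2/p + 2\<close> is large enough. The condition \<open>p (s/2 + 1) > 1\<close> is \<open>2/(s + 2) < p\<close>.\<close>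

lemma oracle_error_finite_exponent:
  fixes P :: "'w measure" and Z :: "real ^ 'n \<Rightarrow> 'w \<Rightarrow> real ^ 'n" and q :: ereal and p \<sigma> :: real
  assumes P: "prob_space P" and Z: "oracle_error P Z q \<sigma>" and q: "2 \<le> q" and p: "2 / (q + 2) < ereal p"
  shows "\<exists>s\<ge>2. p * (s / 2 + 1) > 1 \<and> (\<forall>x. (\<integral>\<^sup>+\<omega>. ennreal (norm (Z x \<omega>) powr s) \<partial>P) \<le> ennreal (\<sigma> powr s))"
proof (cases q)
  case (real s)
  have "s \<ge> 2" using q real by (metis ereal_less_eq(3) numeral_eq_ereal)
  moreover have "2 / (s + 2) < p" using p real \<open>s \<ge> 2\<close> by (simp add: numeral_eq_ereal)
  ultimately have "p * (s / 2 + 1) > 1" by (simp add: field_simps)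
  thus ?thesis using Z real \<open>s \<ge> 2\<close> by (intro exI[of _ s]) (auto simp: oracle_error_def)
next
  case PInf
  interpret prob_space P by fact
  have p0: "p > 0" using p PInf by simp
  define s where "s = 2 / p + 2"
  have "(\<integral>\<^sup>+\<omega>. ennreal (norm (Z x \<omega>) powr s) \<partial>P) \<le> ennreal (\<sigma> powr s)" for x
  proof -
    have "AE \<omega> in P. norm (Z x \<omega>) \<le> \<sigma>" using Z PInf by (auto simp: oracle_error_def)
    hence "(\<integral>\<^sup>+\<omega>. ennreal (norm (Z x \<omega>) powr s) \<partial>P) \<le> (\<integral>\<^sup>+\<omega>. ennreal (\<sigma> powr s) \<partial>P)"
    proof (intro nn_integral_mono_AE, eventually_elim)
      case (elim \<omega>)
      thus ?case using p0 by (intro ennreal_leI powr_mono2) (auto simp: s_def)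
    qed
    thus ?thesis by (simp add: emeasure_space_1)
  qed
  moreover have "s \<ge> 2" using p0 by (simp add: s_def)
  moreover have "p * (s / 2 + 1) > 1" using p0 by (simp add: s_def field_simps)
  ultimately show ?thesis by blast
next
  case MInf
  thus ?thesis using q by simp
qed

section \<open>Local convergence of stochastic gradient descent\<close>

theorem theorem4:
  fixes f :: "real ^ 'n \<Rightarrow> real" and xs :: "real ^ 'n"
    and P :: "'w measure" and Z :: "real ^ 'n \<Rightarrow> 'w \<Rightarrow> real ^ 'n"
    and q :: ereal and \<sigma> \<delta> p :: real
  assumes "\<delta> > 0"
    and "continuously_diff CARD('n) f" and "continuously_diff 2 f"
    and "regular_minimizer f xs"
    and "prob_space P" and "complete_measure P"
    and "2 \<le> q" and "\<sigma> \<ge> 0" and "oracle_error P Z q \<sigma>"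
    and "2 / (q + 2) < ereal p" and "p \<le> 1"
  shows "\<exists>\<gamma>\<^sub>0>0. \<forall>\<gamma>>\<gamma>\<^sub>0. \<exists>m\<^sub>0>0. \<forall>m>m\<^sub>0.
    \<exists>U U\<^sub>1. open U \<and> xs \<in> U \<and> open U\<^sub>1 \<and> xs \<in> U\<^sub>1 \<and>
      (\<forall>(M :: 's measure) X W.
        sgd_run f P Z (\<lambda>n. \<gamma> / (real n + m) powr p) M X W \<and> (AE s in M. X 1 s \<in> U\<^sub>1) \<longrightarrow>
          measure M (stay_event M X U) \<ge> 1 - \<delta> \<and>
          (\<forall>n\<ge>1. integrable (uniform_measure M (stay_event M X U)) (\<lambda>s. (norm (X n s - xs))\<^sup>2)) \<and>
          (\<lambda>n. \<integral>s. (norm (X n s - xs))\<^sup>2 \<partial>uniform_measure M (stay_event M X U))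
            \<in> O(\<lambda>n. 1 / real n powr p))"
proof -
  let "\<exists>\<gamma>\<^sub>0>0. \<forall>\<gamma>>\<gamma>\<^sub>0. \<exists>m\<^sub>0>0. \<forall>m>m\<^sub>0. ?Q \<gamma> m" = ?thesis
  interpret P: prob_space P by fact
  have Zm: "(\<lambda>(x, \<omega>). Z x \<omega>) \<in> borel_measurable (borel \<Otimes>\<^sub>M P)"
    and Zi: "\<And>x. integrable P (Z x)" and Z0: "\<And>x. (\<integral>\<omega>. Z x \<omega> \<partial>P) = 0"
    using assms(9) by (auto simp: oracle_error_def)
  obtain s where s: "s \<ge> 2" "p * (s / 2 + 1) > 1"
    and Zs: "\<And>x. (\<integral>\<^sup>+\<omega>. ennreal (norm (Z x \<omega>) powr s) \<partial>P) \<le> ennreal (\<sigma> powr s)"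
    using oracle_error_finite_exponent[OF assms(5,9,7,10)] by blast
  have p: "p > 0"
    using s by (smt (verit) divide_nonneg_nonneg mult_nonpos_nonneg)
  define S where "S = 1 + \<sigma> powr s"
  have S: "S \<ge> 0" by (simp add: S_def add_nonneg_nonneg)
  have ZS: "(\<integral>\<^sup>+\<omega>. ennreal (norm (Z x \<omega>) powr s) \<partial>P) \<le> ennreal S" for x
    using Zs[of x] by (rule order_trans) (auto simp: S_def intro!: ennreal_leI)
  have Z2: "(\<integral>\<^sup>+\<omega>. ennreal ((norm (Z x \<omega>))\<^sup>2) \<partial>P) \<le> ennreal S" for x
  proof -
    have [measurable]: "Z x \<in> borel_measurable P" using Zi by auto
    have "(\<integral>\<^sup>+\<omega>. ennreal ((norm (Z x \<omega>))\<^sup>2) \<partial>P) \<le> (\<integral>\<^sup>+\<omega>. 1 + ennreal (norm (Z x \<omega>) powr s) \<partial>P)"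
      using square_norm_le_one_plus_powr[OF s(1), where ?'a = "real ^ 'n"]
      by (intro nn_integral_mono) (metis ennreal_1 ennreal_leI ennreal_plus powr_ge_zero zero_le_one)
    also have "\<dots> = 1 + (\<integral>\<^sup>+\<omega>. ennreal (norm (Z x \<omega>) powr s) \<partial>P)"
      by (subst nn_integral_add) (auto simp: P.emeasure_space_1)
    also have "\<dots> \<le> 1 + ennreal (\<sigma> powr s)" using Zs by (intro add_left_mono)
    finally show ?thesis by (simp add: S_def)
  qed

  obtain \<rho> a L where \<rho>: "\<rho> > 0" and a: "a > 0" and L: "L > 0"
    and drift: "\<And>x. x \<in> ball xs \<rho> \<Longrightarrow> a * (norm (x - xs))\<^sup>2 \<le> grad f x \<bullet> (x - xs)"
               "\<And>x. x \<in> ball xs \<rho> \<Longrightarrow> norm (grad f x) \<le> L * norm (x - xs)"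
    using regular_minimizer_drift[OF assms(3,4)] by blast
  \<comment> \<open>Steps up to \<open>g0\<close> are small enough for the noiseless step to contract and for the moment bound.\<close>
  define g0 where "g0 = Min {1, 1 / a, a / L\<^sup>2}"
  have g0: "g0 > 0" using a L by (simp add: g0_def)
  have g0D: "g \<le> 1" "a * g \<le> 1" "g * L\<^sup>2 \<le> a" if "g \<le> g0" for g
    using that a L by (auto simp: g0_def field_simps)
  have one_step: "\<exists>K\<ge>0. \<forall>x\<in>ball xs \<rho>. \<forall>g. 0 < g \<longrightarrow> g \<le> g0 \<longrightarrow>
      (\<integral>\<^sup>+\<omega>. ennreal (norm (x - g *\<^sub>R sgd_oracle f Z x \<omega> - xs) powr t) \<partial>P)
        \<le> ennreal ((1 - a / 2 * g) * norm (x - xs) powr t + K * g powr (t / 2 + 1))"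
    if t: "t \<ge> 2" "\<And>x. (\<integral>\<^sup>+\<omega>. ennreal (norm (Z x \<omega>) powr t) \<partial>P) \<le> ennreal S" for t
  proof -
    obtain K where K: "K \<ge> 0" "\<And>(Q :: 'w measure) (\<zeta> :: 'w \<Rightarrow> real ^ 'n) g r y.
      \<lbrakk>prob_space Q; integrable Q \<zeta>; (\<integral>\<omega>. \<zeta> \<omega> \<partial>Q) = 0;
       (\<integral>\<^sup>+\<omega>. ennreal ((norm (\<zeta> \<omega>))\<^sup>2) \<partial>Q) \<le> ennreal S;
       (\<integral>\<^sup>+\<omega>. ennreal (norm (\<zeta> \<omega>) powr t) \<partial>Q) \<le> ennreal S;
       0 < g; g \<le> 1; a * g \<le> 1; 0 \<le> r; (norm y)\<^sup>2 \<le> (1 - a * g) * r\<^sup>2\<rbrakk> \<Longrightarrow>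
      (\<integral>\<^sup>+\<omega>. ennreal (norm (y - g *\<^sub>R \<zeta> \<omega>) powr t) \<partial>Q)
        \<le> ennreal ((1 - a / 2 * g) * r powr t + K * g powr (t / 2 + 1))"
      using nn_integral_norm_powr_step_le[OF t(1) a S, where ?'w = 'w and ?'a = "real ^ 'n"] by metis
    have "(\<integral>\<^sup>+\<omega>. ennreal (norm (x - g *\<^sub>R sgd_oracle f Z x \<omega> - xs) powr t) \<partial>P)
        \<le> ennreal ((1 - a / 2 * g) * norm (x - xs) powr t + K * g powr (t / 2 + 1))"
      if x: "x \<in> ball xs \<rho>" and g: "0 < g" "g \<le> g0" for x g
    proof -
      have eq: "x - g *\<^sub>R sgd_oracle f Z x \<omega> - xs = (x - xs - g *\<^sub>R grad f x) - g *\<^sub>R Z x \<omega>" for \<omega>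
        by (simp add: sgd_oracle_def algebra_simps)
      have "(norm (x - xs - g *\<^sub>R grad f x))\<^sup>2 \<le> (1 - a * g) * (norm (x - xs))\<^sup>2"
        using drift[OF x] g g0D[OF g(2)] by (intro norm_gradient_step_le) auto
      thus ?thesis
        unfolding eq
        by (intro K(2)[OF assms(5) Zi Z0 Z2 t(2) g(1) g0D(1,2)[OF g(2)] norm_ge_zero])
    qed
    thus ?thesis using K(1) by blast
  qed
  obtain Ks where Ks: "Ks \<ge> 0" "\<And>x g. \<lbrakk>x \<in> ball xs \<rho>; 0 < g; g \<le> g0\<rbrakk> \<Longrightarrow>
      (\<integral>\<^sup>+\<omega>. ennreal (norm (x - g *\<^sub>R sgd_oracle f Z x \<omega> - xs) powr s) \<partial>P)
        \<le> ennreal ((1 - a / 2 * g) * norm (x - xs) powr s + Ks * g powr (s / 2 + 1))"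
    using one_step[OF s(1) ZS] by blast
  have "(\<integral>\<^sup>+\<omega>. ennreal (norm (Z x \<omega>) powr 2) \<partial>P) \<le> ennreal S" for x
    using Z2 by simp
  then obtain K2 where K2: "K2 \<ge> 0" "\<And>x g. \<lbrakk>x \<in> ball xs \<rho>; 0 < g; g \<le> g0\<rbrakk> \<Longrightarrow>
      (\<integral>\<^sup>+\<omega>. ennreal (norm (x - g *\<^sub>R sgd_oracle f Z x \<omega> - xs) powr 2) \<partial>P)
        \<le> ennreal ((1 - a / 2 * g) * norm (x - xs) powr 2 + K2 * g powr (2 / 2 + 1))"
    using one_step[of 2] by blast

  \<comment> \<open>The cap at \<open>1/2\<close> keeps the stay event from having small probability, which would spoil the conditional
    bound.\<close>
  define \<eta> where "\<eta> = min \<delta> (1 / 2)"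
  have \<eta>: "\<eta> > 0" "\<eta> \<le> \<delta>" "\<eta> \<le> 1 / 2" using assms(1) by (auto simp: \<eta>_def)
  \<comment> \<open>The start and the noise may each use half of the exit budget \<open>\<eta> \<rho>\<^sup>s\<close>.\<close>
  define \<rho>1 where "\<rho>1 = \<rho> * (\<eta> / 2) powr (1 / s)"
  have \<rho>1: "\<rho>1 > 0" "\<rho>1 \<le> \<rho>" "\<rho>1 powr s = \<eta> / 2 * \<rho> powr s"
  proof -
    have "(\<eta> / 2) powr (1 / s) \<le> 1 powr (1 / s)" using \<eta> s by (intro powr_mono2) auto
    thus "\<rho>1 \<le> \<rho>" using \<rho> by (simp add: \<rho>1_def mult_left_le)
  qed (use \<rho> \<eta> s in \<open>auto simp: \<rho>1_def powr_mult powr_powr\<close>)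
  have gc: "continuous_on UNIV (grad f)"
    using differentiable_grad[OF assms(3)]
    by (simp add: continuous_at_imp_continuous_on differentiable_imp_continuous_within)

  show ?thesis
  proof (rule exI[of _ "4 / a"], intro conjI allI impI)
    \<comment> \<open>The threshold \<open>4 / a\<close> gives \<open>(a / 2) \<gamma> \<ge> 2\<close>, as the recursion for the rate needs.\<close>
    show "4 / a > 0" using a by simp
    fix \<gamma> :: real assume "\<gamma> > 4 / a"
    hence \<gamma>: "\<gamma> > 0" "a / 2 * \<gamma> \<ge> 2" using a by (auto simp: field_simps intro: less_trans[of 0 "4 / a"])
    define \<beta> where "\<beta> = p * (s / 2 + 1)"
    \<comment> \<open>The \<open>+ 1\<close> keeps the denominator positive when \<open>Ks = 0\<close>.\<close>
    define \<epsilon> where "\<epsilon> = \<eta> / 2 * \<rho> powr s / (Ks * \<gamma> powr (s / 2 + 1) + 1)"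
    have \<epsilon>: "\<epsilon> > 0" using \<eta> \<rho> Ks \<gamma> by (simp add: \<epsilon>_def add_nonneg_pos)
    have "((\<lambda>m. \<gamma> * m powr (- p)) \<longlongrightarrow> \<gamma> * 0) at_top"
      using p by (intro tendsto_mult tendsto_const tendsto_neg_powr filterlim_ident) auto
    hence "\<forall>\<^sub>F m in at_top. \<gamma> * m powr (- p) < g0"
      using g0 by (intro order_tendstoD(2)) auto
    moreover have "\<forall>\<^sub>F m in at_top. \<forall>N. (\<Sum>n = 1..<N. (real n + m) powr (- \<beta>)) \<le> \<epsilon>"
      using s \<epsilon> by (intro shifted_powr_sums_vanish) (auto simp: \<beta>_def)
    ultimately have "\<forall>\<^sub>F m in at_top. \<gamma> * m powr (- p) < g0 \<and> (\<forall>N. (\<Sum>n = 1..<N. (real n + m) powr (- \<beta>)) \<le> \<epsilon>)"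
      by (rule eventually_conj)
    then obtain m1 where m1: "\<And>m. m \<ge> m1 \<Longrightarrow> \<gamma> * m powr (- p) < g0"
        "\<And>m N. m \<ge> m1 \<Longrightarrow> (\<Sum>n = 1..<N. (real n + m) powr (- \<beta>)) \<le> \<epsilon>"
      unfolding eventually_at_top_linorder by blast
    show "\<exists>m\<^sub>0>0. \<forall>m>m\<^sub>0. ?Q \<gamma> m"
    proof (rule exI[of _ "max 1 m1"], intro conjI allI impI)
      show "max 1 m1 > 0" by simp
      fix m assume "m > max 1 m1"
      hence m: "m > 0" "m \<ge> m1" by auto
      define step where "step = (\<lambda>n. \<gamma> / (real n + m) powr p)"
      have step: "0 < step n" "step n \<le> g0" for n
      proof -
        show "0 < step n" using \<gamma> m by (simp add: step_def)
        have "step n \<le> \<gamma> / m powr p"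
          unfolding step_def using \<gamma> m p by (intro divide_left_mono powr_mono2) auto
        also have "\<dots> \<le> g0" using m1(1)[OF m(2)] by (simp add: powr_minus_divide)
        finally show "step n \<le> g0" .
      qed
      have step_powr: "step n powr (s / 2 + 1) = \<gamma> powr (s / 2 + 1) * (real n + m) powr (- \<beta>)" for n
        using \<gamma> m by (simp add: step_def powr_divide powr_powr powr_minus_divide \<beta>_def)
      have noise: "(\<Sum>n = 1..<N. Ks * step n powr (s / 2 + 1)) \<le> \<eta> / 2 * \<rho> powr s" for N
      proof -
        define c where "c = Ks * \<gamma> powr (s / 2 + 1)"
        have c: "c \<ge> 0" using Ks by (simp add: c_def)
        have "(\<Sum>n = 1..<N. Ks * step n powr (s / 2 + 1)) = c * (\<Sum>n = 1..<N. (real n + m) powr (- \<beta>))"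
          by (simp add: step_powr c_def sum_distrib_left mult.assoc)
        also have "\<dots> \<le> (c + 1) * \<epsilon>"
          using m1(2)[OF m(2)] c \<epsilon> by (intro mult_mono sum_nonneg) auto
        also have "\<dots> = \<eta> / 2 * \<rho> powr s"
          using c unfolding \<epsilon>_def c_def[symmetric] times_divide_eq_right[of "c + 1"]
          by (intro nonzero_mult_div_cancel_left) simp
        finally show ?thesis .
      qed
      show "?Q \<gamma> m"
        unfolding step_def[symmetric]
      proof (rule exI[of _ "ball xs \<rho>"], rule exI[of _ "ball xs \<rho>1"], intro conjI allI impI; (elim conjE)?)
        fix M :: "'s measure" and X W
        assume run: "sgd_run f P Z step M X W" and X1: "AE \<omega> in M. X 1 \<omega> \<in> ball xs \<rho>1"
        interpret prob_space M using run by (simp add: sgd_run_def)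
        have M: "prob_space M" by unfold_locales
        have X: "X i \<in> borel_measurable M" if "i \<ge> 1" for i
          using run that by (simp add: sgd_run_def)
        let ?\<Omega> = "stay_event M X (ball xs \<rho>)"
        have sets: "stay_until M X (ball xs \<rho>) n \<in> sets M" for n
          using X by (intro sets_stay_until) auto
        have \<Omega>: "?\<Omega> \<in> sets M" unfolding stay_event_eq_Inter using sets by auto
        have c: "0 \<le> 1 - a / 2 * step n" for n
          using g0D(2)[OF step(2)[of n]] by simp
        have nonneg: "0 \<le> stopped_moment M X xs (ball xs \<rho>) t n" for t n
          by (intro Bochner_Integration.integral_nonneg) simp
        have rec_s: "integrable M (\<lambda>\<omega>. indicator (stay_until M X (ball xs \<rho>) n) \<omega> * norm (X (Suc n) \<omega> - xs) powr s)"
          "(\<integral>\<omega>. indicator (stay_until M X (ball xs \<rho>) n) \<omega> * norm (X (Suc n) \<omega> - xs) powr s \<partial>M)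
            \<le> (1 - a / 2 * step n) * stopped_moment M X xs (ball xs \<rho>) s n + Ks * step n powr (s / 2 + 1)"
          if "n \<ge> 1" for n
          using sgd_stopped_moment_step[OF run assms(5) Zm gc that _ c _ Ks(2)[OF _ step]] s Ks(1) by auto
        have X1': "AE \<omega> in M. X 1 \<omega> \<in> ball xs \<rho>"
          using X1 by eventually_elim (use \<rho>1(2) in auto)
        have start: "stopped_moment M X xs (ball xs \<rho>) s 1 \<le> \<eta> / 2 * \<rho> powr s"
        proof -
          have "stopped_moment M X xs (ball xs \<rho>) s 1 \<le> (\<integral>\<omega>. \<rho>1 powr s \<partial>M)"
          proof (rule integral_mono_AE)
            show "AE \<omega> in M. indicator (stay_until M X (ball xs \<rho>) 1) \<omega> * norm (X 1 \<omega> - xs) powr s \<le> \<rho>1 powr s"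
              using X1
            proof eventually_elim
              case (elim \<omega>)
              hence "norm (X 1 \<omega> - xs) powr s \<le> \<rho>1 powr s"
                using s by (intro powr_mono2) (auto simp: dist_norm norm_minus_commute)
              thus ?case by (auto simp: indicator_def)
            qed
          qed (use integrable_stopped_moment[OF M X, of "\<lambda>i. i" 1 s xs \<rho>] s in auto)
          thus ?thesis by (simp add: prob_space \<rho>1(3))
        qed
        have prob: "prob ?\<Omega> \<ge> 1 - \<eta>"
        proof (rule prob_stay_event_ge[where s = s and k = "\<lambda>n. Ks * step n powr (s / 2 + 1)"])
          fix n :: nat assume n: "n \<ge> 1"
          have "(1 - a / 2 * step n) * stopped_moment M X xs (ball xs \<rho>) s n \<le> 1 * stopped_moment M X xs (ball xs \<rho>) s n"
            using step(1)[of n] a by (intro mult_right_mono nonneg) auto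
          with rec_s(2)[OF n] show "(\<integral>\<omega>. indicator (stay_until M X (ball xs \<rho>) n) \<omega> * norm (X (Suc n) \<omega> - xs) powr s \<partial>M)
            \<le> stopped_moment M X xs (ball xs \<rho>) s n + Ks * step n powr (s / 2 + 1)" by linarith
        next
          fix N
          show "stopped_moment M X xs (ball xs \<rho>) s 1 + (\<Sum>n = 1..<N. Ks * step n powr (s / 2 + 1)) \<le> \<eta> * \<rho> powr s"
            using start noise[of N] by simp
        qed (use M X \<rho> s X1' rec_s(1) in auto)
        thus "prob ?\<Omega> \<ge> 1 - \<delta>" using \<eta> by simp
        have half: "prob ?\<Omega> \<ge> 1 / 2" using prob \<eta> by simp

        \<comment> \<open>Shrinking the stay event from time \<open>n\<close> to \<open>n + 1\<close> only lowers the moment, so the one-step bound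
          with exponent \<open>2\<close> becomes a recursion for \<open>u\<close>.\<close>
        define u where "u n = stopped_moment M X xs (ball xs \<rho>) 2 n" for n
        have rec: "u (Suc n) \<le> (1 - a / 2 * step n) * u n + K2 * (step n)\<^sup>2" if n: "n \<ge> 1" for n
        proof -
          have k: "0 \<le> K2 * (step n)\<^sup>2" using K2(1) by simp
          have K2': "(\<integral>\<^sup>+\<omega>. ennreal (norm (x - step n *\<^sub>R sgd_oracle f Z x \<omega> - xs) powr 2) \<partial>P)
              \<le> ennreal ((1 - a / 2 * step n) * norm (x - xs) powr 2 + K2 * (step n)\<^sup>2)"
            if "x \<in> ball xs \<rho>" for x
            using K2(2)[OF that step[of n]] less_imp_le[OF step(1)[of n]] by simp
          note rec = sgd_stopped_moment_step[OF run assms(5) Zm gc n _ c k K2']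
          have "u (Suc n) \<le> (\<integral>\<omega>. indicator (stay_until M X (ball xs \<rho>) n) \<omega> * norm (X (Suc n) \<omega> - xs) powr 2 \<partial>M)"
            unfolding u_def
          proof (rule integral_mono)
            show "integrable M (\<lambda>\<omega>. indicator (stay_until M X (ball xs \<rho>) (Suc n)) \<omega> * norm (X (Suc n) \<omega> - xs) powr 2)"
              using X by (intro integrable_stopped_moment M) auto
            show "indicator (stay_until M X (ball xs \<rho>) (Suc n)) \<omega> * norm (X (Suc n) \<omega> - xs) powr 2
                \<le> indicator (stay_until M X (ball xs \<rho>) n) \<omega> * norm (X (Suc n) \<omega> - xs) powr 2" for \<omega>
              using stay_until_Suc_subset[of M X "ball xs \<rho>" n] by (auto simp: indicator_def)
          qed (use rec(1) in auto)
          also have "\<dots> \<le> (1 - a / 2 * step n) * u n + K2 * (step n)\<^sup>2"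
            unfolding u_def using rec(2) by simp
          finally show ?thesis .
        qed
        obtain C where C: "C \<ge> 0" "\<And>n. n \<ge> 1 \<Longrightarrow> u n \<le> C / (real n + m) powr p"
          using chung_recursion_bound[of p m "a / 2" \<gamma> u K2] p assms(11) m \<gamma>(2) rec c unfolding step_def by auto
        have cond: "integrable (uniform_measure M ?\<Omega>) (\<lambda>\<omega>. (norm (X n \<omega> - xs))\<^sup>2)"
          "(\<integral>\<omega>. (norm (X n \<omega> - xs))\<^sup>2 \<partial>uniform_measure M ?\<Omega>) \<le> 2 * u n" if n: "n \<ge> 1" for n
        proof -
          have [measurable]: "X n \<in> borel_measurable M" using X n by simp
          have "?\<Omega> \<subseteq> stay_until M X (ball xs \<rho>) n" by (auto simp: stay_event_eq_Inter)
          note um = uniform_measure_integral_le[OF M \<Omega> this half, of "\<lambda>\<omega>. (norm (X n \<omega> - xs))\<^sup>2"]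
          have "integrable M (\<lambda>\<omega>. indicator (stay_until M X (ball xs \<rho>) n) \<omega> * (norm (X n \<omega> - xs))\<^sup>2)"
            using integrable_stopped_moment[OF M X n, of "\<lambda>i. i" 2 xs \<rho>] by simp
          with um show "integrable (uniform_measure M ?\<Omega>) (\<lambda>\<omega>. (norm (X n \<omega> - xs))\<^sup>2)"
            "(\<integral>\<omega>. (norm (X n \<omega> - xs))\<^sup>2 \<partial>uniform_measure M ?\<Omega>) \<le> 2 * u n"
            by (simp_all add: u_def)
        qed
        show "integrable (uniform_measure M ?\<Omega>) (\<lambda>\<omega>. (norm (X n \<omega> - xs))\<^sup>2)" if "n \<ge> 1" for n
          using cond(1)[OF that] .
        show "(\<lambda>n. \<integral>\<omega>. (norm (X n \<omega> - xs))\<^sup>2 \<partial>uniform_measure M ?\<Omega>) \<in> O(\<lambda>n. 1 / real n powr p)"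
        proof (rule bigoI[of _ "2 * C"], rule eventually_mono[OF eventually_ge_at_top[of 1]])
          fix n :: nat assume n: "n \<ge> 1"
          have "(\<integral>\<omega>. (norm (X n \<omega> - xs))\<^sup>2 \<partial>uniform_measure M ?\<Omega>) \<le> 2 * (C / (real n + m) powr p)"
            using cond(2)[OF n] C(2)[OF n] by linarith
          also have "\<dots> \<le> 2 * (C / real n powr p)"
            using n m p C(1) by (intro mult_left_mono divide_left_mono powr_mono2) auto
          finally show "norm (\<integral>\<omega>. (norm (X n \<omega> - xs))\<^sup>2 \<partial>uniform_measure M ?\<Omega>)
              \<le> 2 * C * norm (1 / real n powr p)" by simp
        qed
      qed (use \<rho> \<rho>1 in auto)
    qed
  qed
qed

end
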